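(* Let $X$ be a locally compact Hausdorff space and let $V$ be a non-trivial metrizable topological vector space (over $\mathbb R$ or $\mathbb C$). If $X$ is not pseudocompact, then the following are equivalent: (i) the family $\{C_K(X,V)\}_{K\in\mathscr{K}(X)}$ satisfies ACP; (ii) $X$ is homeomorphic to $\mathbb N$ with the discrete topology and $V$ is finite dimensional.
   Context: A space is pseudocompact if every continuous real-valued function on it is bounded. $\mathscr K(X)$ is the set of compact subsets of $X$, ordered by inclusion. $C_K(X,V)$ is the group (under pointwise addition) of continuous $f\colon X\to V$ whose support $\operatorname{cl}_X\{x\mid f(x)\neq 0\}$ is contained in $K$, with the topology of uniform convergence; the family has inclusions as bonding maps. For a directed family $\{G_\alpha\}$ of topological groups with inclusions that are closed embeddings as bonding maps and union $G$, the colimit space topology is $\mathscr T=\{U\subseteq G\mid U\cap G_\alpha\text{ open in }G_\alpha\ \forall\alpha\}$; the family satisfies ACP if $(G,\mathscr T)$ is a topological group (equivalently, $\mathscr T$ equals the finest group topology making all inclusions continuous). *)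

theory Defs
  imports "HOL-Analysis.Analysis"
begin

text \<open>A real topological vector space: the type's topology makes addition and
  scalar multiplication jointly continuous.  (Complex TVSs are in particular real TVSs.)\<close>
definition real_tvs :: "'v::{real_vector,topological_space} itself \<Rightarrow> bool" where
  "real_tvs _ \<longleftrightarrow>
     continuous_on UNIV (\<lambda>p::'v \<times> 'v. fst p + snd p) \<and>
     continuous_on UNIV (\<lambda>p::real \<times> 'v. fst p *\<^sub>R snd p)"

definition finite_dim_space :: "'v::real_vector itself \<Rightarrow> bool" where
  "finite_dim_space _ \<longleftrightarrow> (\<exists>B::'v set. finite B \<and> span B = UNIV)"

definition pseudocompact :: "'a topology \<Rightarrow> bool" where
  "pseudocompact X \<longleftrightarrow>
     (\<forall>f. continuous_map X euclideanreal f \<longrightarrow> bounded (f ` topspace X))"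

definition supp_in :: "'a topology \<Rightarrow> ('a \<Rightarrow> 'v::zero) \<Rightarrow> 'a set" where
  "supp_in X f = X closure_of {x \<in> topspace X. f x \<noteq> 0}"

text \<open>C_K(X,V): continuous functions X \<rightarrow> V with support contained in K
  (functions are normalised to 0 outside the carrier of X).\<close>
definition CK :: "'a topology \<Rightarrow> 'a set \<Rightarrow> ('a \<Rightarrow> 'v::{real_vector,topological_space}) set" where
  "CK X K = {f. (\<forall>x. x \<notin> topspace X \<longrightarrow> f x = 0) \<and>
                continuous_map X euclidean f \<and> supp_in X f \<subseteq> K}"

text \<open>Openness for the topology of uniform convergence on a set S of functions
  (w.r.t. the canonical uniformity of the topological vector space V).\<close>
definition unif_open :: "'a topology \<Rightarrow> ('a \<Rightarrow> 'v::{real_vector,topological_space}) set \<Rightarrow> ('a \<Rightarrow> 'v) set \<Rightarrow> bool" where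
  "unif_open X S W \<longleftrightarrow> W \<subseteq> S \<and>
     (\<forall>f\<in>W. \<exists>U. open U \<and> (0::'v) \<in> U \<and>
        {g \<in> S. \<forall>x\<in>topspace X. g x - f x \<in> U} \<subseteq> W)"

definition CK_union :: "'a topology \<Rightarrow> ('a \<Rightarrow> 'v::{real_vector,topological_space}) set" where
  "CK_union X = \<Union>{CK X K | K. compactin X K}"

definition colim_top :: "'a topology \<Rightarrow> ('a \<Rightarrow> 'v::{real_vector,topological_space}) topology" where
  "colim_top X = topology (\<lambda>W. W \<subseteq> CK_union X \<and>
      (\<forall>K. compactin X K \<longrightarrow> unif_open X (CK X K) (W \<inter> CK X K)))"

definition CK_ACP :: "'a topology \<Rightarrow> 'v::{real_vector,topological_space} itself \<Rightarrow> bool" where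
  "CK_ACP X _ \<longleftrightarrow>
     (let T = (colim_top X :: ('a \<Rightarrow> 'v) topology) in
        continuous_map (prod_topology T T) T (\<lambda>p. (\<lambda>x. fst p x + snd p x)) \<and>
        continuous_map T T (\<lambda>f. (\<lambda>x. - f x)))"

end

theory Submission
  imports Defs
begin

text \<open>
  If some group C_L(X,V) with L compact contains, in every neighbourhood of 0, a uniformly discrete
  sequence, then bumps that run away along a sequence on which an unbounded continuous function
  tends to infinity turn these sequences into a closed set not containing 0 that meets U + U for every
  neighbourhood U of 0, so addition is not continuous at 0. This happens when V is infinite dimensional
  (Riesz) and when X has a non-isolated point. An uncountable discrete X is excluded by a closed set of
  functions supported on two points. Conversely, if X is countable and discrete and V is finite
  dimensional, V is locally compact, and the tube lemma, applied one coordinate at a time, shows that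
  boxes form a neighbourhood base of the colimit topology.
\<close>

section \<open>Hausdorff topological vector spaces\<close>

text \<open>Openness in the colimit is tested on one group \<open>CK X K\<close> at a time. Closed
  sets are therefore cheap: it suffices that the members living on each compact set can be kept away
  from any other function. That is what defeats addition, and also why sufficiency is delicate,
  since an open set comes with no estimate uniform in \<open>K\<close>. In the necessity arguments a
  continuous function is bounded on compact sets, so points with growing values of \<open>h\<close>
  let only finitely many indices \<open>n\<close> matter on each compact set. Metrizability provides
  a base at 0 indexed by the same \<open>n\<close>, hence one separated sequence for each basic
  neighbourhood. In the sufficiency argument compactness of the box is the invariant: the
  neighbourhood found for the next coordinate must serve all points of the box built so far, and
  must again have compact closure control, so that the next step can start. Countability lets the
  steps exhaust the space. No norm or local convexity is at hand in \<open>V\<close>; balanced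
  neighbourhoods and absorption of single vectors take their place.\<close>

lemma compact_function_box:
  fixes C :: "'b \<Rightarrow> 'c::topological_space set"
  assumes "\<And>x. compact (C x)" shows "compact {f. \<forall>x. f x \<in> C x}"
proof -
  \<comment> \<open>Tychonoff, transferred to the function type, whose own topology is the product
    topology.\<close>
  have "compactin (product_topology (\<lambda>x::'b. euclidean :: 'c topology) UNIV) (PiE UNIV C)"
    using assms by (simp add: compactin_PiE)
  then show ?thesis
    by (simp add: euclidean_product_topology PiE_UNIV_domain Pi_def)
qed

text \<open>Metrizability is split into what it supplies: the Hausdorff axiom here, a countable base
  at 0 in \<open>countable_balanced_base\<close>. A complex space is regarded as a real one; finite
  dimension means the same over both fields.\<close>

locale hausdorff_tvs =
  fixes V :: "'v::{real_vector,topological_space} itself"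
  assumes tvs: "real_tvs V" and hausdorff: "Hausdorff_space (euclidean :: 'v topology)"
begin

section \<open>Continuity of the vector operations\<close>

lemma continuous_on_plus:
  fixes f g :: "'b::topological_space \<Rightarrow> 'v"
  assumes "continuous_on S f" "continuous_on S g"
  shows "continuous_on S (\<lambda>x. f x + g x)"
proof -
  have "continuous_on UNIV (\<lambda>p::'v \<times> 'v. fst p + snd p)"
    using tvs by (simp add: real_tvs_def)
  from continuous_on_compose2[OF this continuous_on_Pair[OF assms]] show ?thesis by simp
qed

lemma continuous_on_smult:
  fixes f :: "'b::topological_space \<Rightarrow> real" and g :: "'b \<Rightarrow> 'v"
  assumes "continuous_on S f" "continuous_on S g"
  shows "continuous_on S (\<lambda>x. f x *\<^sub>R g x)"
proof -
  have "continuous_on UNIV (\<lambda>p::real \<times> 'v. fst p *\<^sub>R snd p)"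
    using tvs by (simp add: real_tvs_def)
  from continuous_on_compose2[OF this continuous_on_Pair[OF assms]] show ?thesis by simp
qed

lemma continuous_on_setsum:
  fixes f :: "'c \<Rightarrow> 'b::topological_space \<Rightarrow> 'v"
  assumes "\<And>i. i \<in> I \<Longrightarrow> continuous_on S (f i)"
  shows "continuous_on S (\<lambda>x. \<Sum>i\<in>I. f i x)"
  using assms by (induction I rule: infinite_finite_induct) (auto intro: continuous_on_plus)

lemma open_translation_vimage:
  assumes "open (U :: 'v set)" shows "open {x. x - a \<in> U}"
proof -
  have "continuous_on UNIV (\<lambda>x::'v. x + (- a))"
    by (intro continuous_on_plus continuous_intros)
  from open_vimage[OF assms this] show ?thesis by (simp add: vimage_def)
qed

lemma open_smult_vimage:
  assumes "open (U :: 'v set)" shows "open {x. c *\<^sub>R x \<in> U}"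
proof -
  have "continuous_on UNIV (\<lambda>x::'v. c *\<^sub>R x)"
    by (intro continuous_on_smult continuous_intros)
  from open_vimage[OF assms this] show ?thesis by (simp add: vimage_def)
qed

lemma open_smult_image:
  assumes "open (U :: 'v set)" "c \<noteq> 0" shows "open ((*\<^sub>R) c ` U)"
proof -
  have "(*\<^sub>R) c ` U = {x. (1/c) *\<^sub>R x \<in> U}"
  proof (intro set_eqI iffI)
    fix x assume "x \<in> {x. (1/c) *\<^sub>R x \<in> U}"
    moreover have "x = c *\<^sub>R ((1/c) *\<^sub>R x)" using assms by simp
    ultimately show "x \<in> (*\<^sub>R) c ` U" by blast
  qed (use assms in auto)
  then show ?thesis using open_smult_vimage[OF assms(1)] by simp
qed

section \<open>Neighbourhoods of 0\<close>

lemma add_nhd: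
  assumes "open (U :: 'v set)" "0 \<in> U"
  obtains N where "open N" "0 \<in> N" "\<And>a b. a \<in> N \<Longrightarrow> b \<in> N \<Longrightarrow> a + b \<in> U"
proof -
  have "continuous_on UNIV (\<lambda>p::'v \<times> 'v. fst p + snd p)"
    using tvs by (simp add: real_tvs_def)
  from open_vimage[OF assms(1) this]
  have "open ((\<lambda>p::'v \<times> 'v. fst p + snd p) -` U)" .
  moreover have "(0,0) \<in> (\<lambda>p::'v \<times> 'v. fst p + snd p) -` U" using assms by simp
  ultimately obtain A B where "open A" "open B" "(0,0) \<in> A \<times> B"
    "A \<times> B \<subseteq> (\<lambda>p::'v \<times> 'v. fst p + snd p) -` U"
    by (rule open_prod_elim)
  then show ?thesis by (intro that[of "A \<inter> B"]) auto
qed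

text \<open>The stand-in for balls. Invariance under factors of modulus at most 1 keeps a vector of
  the neighbourhood inside it when it is multiplied by a bump function with values in [0,1].\<close>

definition balanced :: "'v set \<Rightarrow> bool" where
  "balanced N \<longleftrightarrow> (\<forall>x\<in>N. \<forall>t::real. \<bar>t\<bar> \<le> 1 \<longrightarrow> t *\<^sub>R x \<in> N)"

lemma balancedD: "balanced N \<Longrightarrow> x \<in> N \<Longrightarrow> \<bar>t\<bar> \<le> 1 \<Longrightarrow> t *\<^sub>R x \<in> N"
  by (simp add: balanced_def)

lemma balanced_uminus: "balanced N \<Longrightarrow> x \<in> N \<Longrightarrow> - x \<in> N"
  unfolding balanced_def by (metis abs_minus_cancel abs_one order_refl scaleR_minus1_left)

lemma balanced_nhd:
  assumes "open (U :: 'v set)" "0 \<in> U"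
  obtains N where "open N" "0 \<in> N" "N \<subseteq> U" "balanced N"
proof -
  have "continuous_on UNIV (\<lambda>p::real \<times> 'v. fst p *\<^sub>R snd p)"
    using tvs by (simp add: real_tvs_def)
  from open_vimage[OF assms(1) this]
  have "open ((\<lambda>p::real \<times> 'v. fst p *\<^sub>R snd p) -` U)" .
  moreover have "(0,0) \<in> (\<lambda>p::real \<times> 'v. fst p *\<^sub>R snd p) -` U" using assms by simp
  ultimately obtain A B where AB: "open A" "open B" "(0,0) \<in> A \<times> B"
    "A \<times> B \<subseteq> (\<lambda>p::real \<times> 'v. fst p *\<^sub>R snd p) -` U"
    by (rule open_prod_elim)
  obtain d where d: "d > 0" "\<And>t. \<bar>t\<bar> < d \<Longrightarrow> t \<in> A"
    using AB(1,3) by (auto simp: open_dist dist_real_def)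
  \<comment> \<open>The factor \<open>t = 0\<close> is left out so that every piece of the union is
    open; 0 is in \<open>N\<close> anyway because it is in \<open>B\<close>.\<close>
  define N where "N = (\<Union>t\<in>{t. t \<noteq> 0 \<and> \<bar>t\<bar> < d}. (*\<^sub>R) t ` B)"
  have "open N" unfolding N_def using AB(2) by (auto intro: open_smult_image)
  moreover have z: "0 \<in> N"
    unfolding N_def using d(1) AB(3) by (auto intro!: exI[of _ "d/2"] image_eqI[of _ _ 0])
  moreover have "N \<subseteq> U"
  proof
    fix x assume "x \<in> N"
    then obtain t b where "\<bar>t\<bar> < d" "b \<in> B" "x = t *\<^sub>R b" by (auto simp: N_def)
    then show "x \<in> U" using AB(4) d(2)[of t] by (auto dest!: subsetD[of _ _ "(t,b)"])
  qed
  moreover have "balanced N"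
    unfolding balanced_def
  proof (intro ballI allI impI)
    fix x s assume "x \<in> N" and s: "\<bar>s\<bar> \<le> (1::real)"
    then obtain t b where tb: "t \<noteq> 0" "\<bar>t\<bar> < d" "b \<in> B" "x = t *\<^sub>R b" by (auto simp: N_def)
    show "s *\<^sub>R x \<in> N"
    proof (cases "s = 0")
      case False
      have "\<bar>s * t\<bar> < d" using s tb(2) mult_left_le_one_le[of "\<bar>t\<bar>" "\<bar>s\<bar>"]
        by (simp add: abs_mult)
      then show ?thesis using False tb unfolding N_def
        by (intro UN_I[of "s * t"]) auto
    qed (use z in simp)
  qed
  ultimately show ?thesis by (rule that)
qed

lemma balanced_add_nhd:
  assumes "open (U :: 'v set)" "0 \<in> U"
  obtains N where "open N" "0 \<in> N" "balanced N" "\<forall>a\<in>N. \<forall>b\<in>N. a + b \<in> U \<and> a - b \<in> U"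
proof -
  obtain M where M: "open M" "0 \<in> M" "\<And>a b. a \<in> M \<Longrightarrow> b \<in> M \<Longrightarrow> a + b \<in> U"
    using add_nhd[OF assms] by blast
  obtain N where N: "open N" "0 \<in> N" "N \<subseteq> M" "balanced N"
    using balanced_nhd[OF M(1,2)] by blast
  have "a - b \<in> U" if "a \<in> N" "b \<in> N" for a b
    using M(3)[of a "- b"] N(3) that balanced_uminus[OF N(4)] by auto
  moreover have "a + b \<in> U" if "a \<in> N" "b \<in> N" for a b
    using M(3) N(3) that by auto
  ultimately show ?thesis by (intro that[OF N(1,2,4)]) auto
qed

lemma eventually_smult_in_nhd:
  assumes "open (U :: 'v set)" "0 \<in> U"
  obtains c where "c > 0" "\<And>t::real. \<bar>t\<bar> < c \<Longrightarrow> t *\<^sub>R x \<in> U"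
proof -
  have "continuous_on UNIV (\<lambda>t::real. t *\<^sub>R x)"
    by (intro continuous_on_smult continuous_intros)
  from open_vimage[OF assms(1) this] have "open ((\<lambda>t. t *\<^sub>R x) -` U)" .
  moreover have "0 \<in> (\<lambda>t. t *\<^sub>R x) -` U" using assms(2) by simp
  ultimately obtain c where "c > 0" "\<And>t. dist t 0 < c \<Longrightarrow> t \<in> (\<lambda>t. t *\<^sub>R x) -` U"
    unfolding open_dist by blast
  then show ?thesis by (intro that[of c]) (auto simp: dist_real_def)
qed

lemma nhd_avoiding:
  assumes "x \<noteq> (0::'v)" obtains U where "open U" "0 \<in> U" "x \<notin> U"
proof -
  have "x \<in> topspace euclidean \<and> 0 \<in> topspace euclidean \<and> x \<noteq> (0::'v)" using assms by simp
  then obtain A U where "open A" "open U" "x \<in> A" "(0::'v) \<in> U" "disjnt A U"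
    using hausdorff unfolding Hausdorff_space_def by (metis open_openin)
  then show ?thesis using that by (auto simp: disjnt_iff)
qed

lemma compact_closed:
  "compact (K :: 'v set) \<Longrightarrow> closed K"
  using compactin_imp_closedin[OF hausdorff, of K] by simp

section \<open>Finite-dimensional subspaces\<close>

definition lin_comb :: "'v set \<Rightarrow> ('v \<Rightarrow> real) \<Rightarrow> 'v" where
  "lin_comb B c = (\<Sum>b\<in>B. c b *\<^sub>R b)"

text \<open>The cube [-r,r]^B, coded among the functions on the whole type. Pinning the coefficients
  off \<open>B\<close> to 0 makes it a product of compact sets.\<close>

definition coeff_box :: "'v set \<Rightarrow> real \<Rightarrow> ('v \<Rightarrow> real) set" where
  "coeff_box B r = {c. \<forall>b. if b \<in> B then \<bar>c b\<bar> \<le> r else c b = 0}"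

lemma continuous_on_lin_comb: "continuous_on S (lin_comb B)"
  unfolding lin_comb_def
  by (intro continuous_on_setsum continuous_on_smult continuous_intros
      continuous_on_subset[OF continuous_on_product_coordinates]) auto

lemma compact_coeff_box: "compact (coeff_box B r)"
proof -
  have "coeff_box B r = {c. \<forall>b. c b \<in> (if b \<in> B then {-r..r} else {0})}"
    by (auto simp: coeff_box_def abs_le_iff minus_le_iff split: if_splits)
  then show ?thesis by (simp add: compact_function_box)
qed

lemma compact_lin_comb_box: "compact (lin_comb B ` coeff_box B r)"
  by (intro compact_continuous_image continuous_on_lin_comb compact_coeff_box)

lemma lin_comb_in_span: "lin_comb B c \<in> span B"
  unfolding lin_comb_def by (intro span_sum span_scale span_base)

lemma span_eq_lin_comb:
  assumes "finite B" "x \<in> span B"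
  obtains c where "x = lin_comb B c" "\<And>b. b \<notin> B \<Longrightarrow> c b = 0"
proof -
  obtain u where u: "x = (\<Sum>b\<in>B. u b *\<^sub>R b)"
    using assms span_finite[of B] by auto
  show ?thesis
    by (rule that[of "\<lambda>b. if b \<in> B then u b else 0"])
       (auto simp: lin_comb_def u intro: sum.cong)
qed

lemma spanning_independent_subset:
  obtains C where "C \<subseteq> B" "independent C" "span C = span (B :: 'v set)"
proof -
  obtain C where "C \<subseteq> B" "independent C" "B \<subseteq> span C" using maximal_independent_subset by blast
  then show ?thesis using that span_mono[of C B] span_minimal[of B "span C"] by auto
qed

text \<open>On an independent set the image of the unit sphere of coefficients is compact and misses
  the origin; a balanced neighbourhood missing it meets the span only in combinations with
  coefficients at most 1.\<close>
lemma nhd_meets_span_in_box: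
  assumes "finite B" "independent B"
  obtains N where "open N" "0 \<in> N" "balanced N" "N \<inter> span B \<subseteq> lin_comb B ` coeff_box B 1"
proof -
  define S where "S = coeff_box B 1 \<inter> (\<Union>b\<in>B. {c. \<bar>c b\<bar> = 1})"
  have "closed (\<Union>b\<in>B. {c::'v \<Rightarrow> real. \<bar>c b\<bar> = 1})"
    using assms(1) by (intro closed_UN closed_Collect_eq ballI continuous_intros) auto
  then have "compact (lin_comb B ` S)"
    unfolding S_def
    by (intro compact_continuous_image continuous_on_lin_comb compact_Int_closed compact_coeff_box)
  then have "open (- lin_comb B ` S)" using compact_closed by blast
  moreover have "0 \<notin> lin_comb B ` S"
  proof
    assume "0 \<in> lin_comb B ` S"
    then obtain c b where "lin_comb B c = 0" "b \<in> B" "\<bar>c b\<bar> = 1" by (auto simp: S_def)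
    then show False
      using independentD[OF assms(2,1) order_refl, of c b] by (simp add: lin_comb_def)
  qed
  ultimately obtain N where N: "open N" "0 \<in> N" "N \<subseteq> - lin_comb B ` S" "balanced N"
    using balanced_nhd[of "- lin_comb B ` S"] by auto
  have "x \<in> lin_comb B ` coeff_box B 1" if x: "x \<in> N" "x \<in> span B" for x
  proof -
    obtain c where c: "x = lin_comb B c" "\<And>b. b \<notin> B \<Longrightarrow> c b = 0"
      using span_eq_lin_comb[OF assms(1) x(2)] by blast
    have "c \<in> coeff_box B 1"
    proof (rule ccontr)
      assume "c \<notin> coeff_box B 1"
      then obtain b0 where b0: "b0 \<in> B" "\<bar>c b0\<bar> > 1"
        using c(2) unfolding coeff_box_def mem_Collect_eq by (metis not_le)
      \<comment> \<open>Dividing by the largest modulus of a coefficient puts the coefficients on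
        the unit sphere \<open>S\<close>. As \<open>m > 1\<close>, balancedness keeps the scaled
        vector in \<open>N\<close>, which misses the image of \<open>S\<close>.\<close>
      define m where "m = Max ((\<lambda>b. \<bar>c b\<bar>) ` B)"
      have m: "\<bar>c b\<bar> \<le> m" if "b \<in> B" for b using that assms(1) by (simp add: m_def)
      have "m \<in> (\<lambda>b. \<bar>c b\<bar>) ` B"
        unfolding m_def using assms(1) b0(1) by (intro Max_in) auto
      then obtain b where b: "b \<in> B" "\<bar>c b\<bar> = m" by blast
      have m1: "m > 1" using m[OF b0(1)] b0(2) by linarith
      have "(\<lambda>b. c b / m) \<in> S"
        unfolding S_def coeff_box_def using m m1 c(2) b by (auto intro!: bexI[of _ b])
      then have "lin_comb B (\<lambda>b. c b / m) \<in> lin_comb B ` S" by blast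
      moreover have "lin_comb B (\<lambda>b. c b / m) = (1/m) *\<^sub>R x"
        by (simp add: lin_comb_def c(1) scaleR_sum_right)
      moreover have "(1/m) *\<^sub>R x \<in> N"
        using N(4) x(1) m1 unfolding balanced_def by auto
      ultimately show False using N(3) by auto
    qed
    then show ?thesis using c(1) by blast
  qed
  then show ?thesis using N that by blast
qed

lemma coeff_box_scale: "c \<in> coeff_box B 1 \<Longrightarrow> t \<ge> 0 \<Longrightarrow> (\<lambda>b. t * c b) \<in> coeff_box B t"
  unfolding coeff_box_def by (auto simp: abs_mult mult_left_le split: if_splits)

lemma lin_comb_scale: "lin_comb B (\<lambda>b. t * c b) = t *\<^sub>R lin_comb B c"
  by (simp add: lin_comb_def scaleR_sum_right)

text \<open>Closedness is local: a suitable multiple of \<open>N\<close> is an open set around a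
  given point of the closure, and inside it the span is covered by the image of a coefficient cube.
  That image is compact, hence closed, and so contains the point.\<close>

lemma closed_finite_span:
  assumes "finite (B :: 'v set)" shows "closed (span B)"
proof -
  obtain C where C: "C \<subseteq> B" "independent C" "span C = span B"
    using spanning_independent_subset by blast
  then have fin: "finite C" using assms finite_subset by blast
  obtain N where N: "open N" "0 \<in> N" "balanced N" "N \<inter> span C \<subseteq> lin_comb C ` coeff_box C 1"
    using nhd_meets_span_in_box[OF fin C(2)] by blast
  have "x \<in> span C" if x: "x \<in> closure (span C)" for x
  proof -
    obtain e where e: "e > 0" "\<And>t::real. \<bar>t\<bar> < e \<Longrightarrow> t *\<^sub>R x \<in> N"
      using eventually_smult_in_nhd[OF N(1,2), of x] by blast
    define t where "t = 2 / e"
    have t: "t > 0" "(1/t) *\<^sub>R x \<in> N" using e(1) e(2)[of "1/t"] by (auto simp: t_def)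
    have op: "open {y. (1/t) *\<^sub>R y \<in> N}" using open_smult_vimage[OF N(1)] .
    have cl: "closed (lin_comb C ` coeff_box C t)" by (intro compact_closed compact_lin_comb_box)
    have sub: "{y. (1/t) *\<^sub>R y \<in> N} \<inter> span C \<subseteq> lin_comb C ` coeff_box C t"
    proof
      fix y assume "y \<in> {y. (1/t) *\<^sub>R y \<in> N} \<inter> span C"
      then have "(1/t) *\<^sub>R y \<in> N \<inter> span C" by (auto intro: span_scale)
      then obtain c where c: "c \<in> coeff_box C 1" "(1/t) *\<^sub>R y = lin_comb C c" using N(4) by blast
      have "y = t *\<^sub>R ((1/t) *\<^sub>R y)" using t by simp
      also have "\<dots> = lin_comb C (\<lambda>b. t * c b)" by (simp only: c(2) lin_comb_scale)
      finally show "y \<in> lin_comb C ` coeff_box C t"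
        using coeff_box_scale[OF c(1), of t] t(1) by auto
    qed
    have "x \<in> {y. (1/t) *\<^sub>R y \<in> N} \<inter> closure (span C)" using t x by simp
    also have "\<dots> \<subseteq> closure ({y. (1/t) *\<^sub>R y \<in> N} \<inter> span C)"
      using op by (rule open_Int_closure_subset)
    also have "\<dots> \<subseteq> lin_comb C ` coeff_box C t" using sub cl by (rule closure_minimal)
    finally show ?thesis using lin_comb_in_span by auto
  qed
  then show ?thesis unfolding C(3)[symmetric]
    by (metis closure_closed closure_subset closed_closure subset_antisym subsetI)
qed

text \<open>With the span equal to the whole space, \<open>N\<close> itself lies in the compact
  image of the unit cube; both are then shrunk by one common factor to fit into
  \<open>U\<close>.\<close>

lemma finite_dim_compact_nhd:
  assumes "finite_dim_space V" "open (U :: 'v set)" "0 \<in> U"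
  obtains N K where "open N" "0 \<in> N" "N \<subseteq> K" "compact K" "K \<subseteq> U"
proof -
  obtain B :: "'v set" where B: "finite B" "span B = UNIV"
    using assms(1) by (auto simp: finite_dim_space_def)
  obtain C where C: "C \<subseteq> B" "independent C" "span C = UNIV"
    using spanning_independent_subset B(2) by metis
  then have fin: "finite C" using B finite_subset by blast
  obtain N where N: "open N" "0 \<in> N" "balanced N" "N \<inter> span C \<subseteq> lin_comb C ` coeff_box C 1"
    by (rule nhd_meets_span_in_box[OF fin C(2)])
  have N3: "N \<subseteq> lin_comb C ` coeff_box C 1" using N(4) by (simp add: C(3))
  let ?K = "lin_comb C ` coeff_box C 1"
  have "continuous_on UNIV (\<lambda>p::real \<times> 'v. fst p *\<^sub>R snd p)"
    using tvs by (simp add: real_tvs_def)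
  then have "open ((\<lambda>p::real \<times> 'v. fst p *\<^sub>R snd p) -` U)" using open_vimage[OF assms(2)] by blast
  moreover have "{0} \<times> ?K \<subseteq> (\<lambda>p::real \<times> 'v. fst p *\<^sub>R snd p) -` U" using assms(3) by auto
  \<comment> \<open>The tube lemma around \<open>{0} \<times> ?K\<close> yields scalars that push
    all of \<open>?K\<close> into \<open>U\<close> at once.\<close>
  ultimately obtain A where A: "open A" "0 \<in> A" "A \<times> ?K \<subseteq> (\<lambda>p::real \<times> 'v. fst p *\<^sub>R snd p) -` U"
    using Elementary_Topology.tube_lemma[OF compact_lin_comb_box[of C 1], of _ "0::real"] by blast
  obtain e where "e > 0" "ball 0 e \<subseteq> A" using A(1,2) open_contains_ball by blast
  then have t: "e / 2 > 0" "e / 2 \<in> A" by (auto simp: dist_real_def)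
  define t where "t = e / 2"
  note t = t[folded t_def]
  show ?thesis
  proof
    show "open ((*\<^sub>R) t ` N)" using t N by (intro open_smult_image) auto
    show "0 \<in> (*\<^sub>R) t ` N" using N by force
    show "(*\<^sub>R) t ` N \<subseteq> (*\<^sub>R) t ` ?K" using N3 by blast
    show "compact ((*\<^sub>R) t ` ?K)"
      by (intro compact_continuous_image continuous_on_smult compact_lin_comb_box continuous_intros)
    show "(*\<^sub>R) t ` ?K \<subseteq> U"
    proof clarify
      fix c assume "c \<in> coeff_box C 1"
      then have "(t, lin_comb C c) \<in> A \<times> ?K" using t(2) by blast
      with A(3) have "(t, lin_comb C c) \<in> (\<lambda>p. fst p *\<^sub>R snd p) -` U" by blast
      then show "t *\<^sub>R lin_comb C c \<in> U" by simp
    qed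
  qed
qed

text \<open>Riesz: if a neighbourhood of 0 is totally bounded, it lies in F + U/2 for a finite set F, hence
  in the closure of the span of F.\<close>
lemma infinite_dim_separated_sequence:
  assumes "\<not> finite_dim_space V" "open (U :: 'v set)" "0 \<in> U"
  obtains v :: "nat \<Rightarrow> 'v" and N
  where "\<forall>k. v k \<in> U" "open N" "0 \<in> N" "\<forall>j k. j < k \<longrightarrow> v k - v j \<notin> N"
proof (rule ccontr)
  assume "\<not> thesis"
  then have no: "\<not> ((\<forall>k. v k \<in> U) \<and> open N \<and> 0 \<in> N \<and> (\<forall>j k. j < k \<longrightarrow> v k - v j \<notin> N))"
    for v :: "nat \<Rightarrow> 'v" and N using that by blast
  have tb: "\<exists>F. finite F \<and> (\<forall>u\<in>U. \<exists>f\<in>F. u - f \<in> N)" if N: "open N" "0 \<in> N" for N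
  proof (rule ccontr)
    assume neg: "\<not> ?thesis"
    have "\<exists>u\<in>U. \<forall>f\<in>F. u - f \<notin> N" if "finite F" for F using neg that by blast
    then obtain g where g: "\<And>F. finite F \<Longrightarrow> g F \<in> U \<and> (\<forall>f\<in>F. g F - f \<notin> N)" by metis
    \<comment> \<open>Greedy choice: \<open>w k\<close> lists the first \<open>k\<close> terms, and
      the next one is chosen away from all of them.\<close>
    define w where "w = rec_nat [] (\<lambda>_ l. g (set l) # l)"
    define v where "v k = g (set (w k))" for k
    have w: "w (Suc k) = v k # w k" for k by (simp add: w_def v_def)
    have "v j \<in> set (w k)" if "j < k" for j k
      using that by (induction k) (auto simp: w less_Suc_eq)
    then show False using no[of v N] g N unfolding v_def by blast
  qed
  obtain M where M: "open M" "0 \<in> M" "M \<subseteq> U" "balanced M" using balanced_nhd[OF assms(2,3)] by blast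
  have "open {x. 2 *\<^sub>R x \<in> M}" using open_smult_vimage[OF M(1)] .
  then obtain F where F: "finite F" "\<And>u. u \<in> U \<Longrightarrow> \<exists>f\<in>F. 2 *\<^sub>R (u - f) \<in> M"
    using tb[of "{x. 2 *\<^sub>R x \<in> M}"] M(2) by auto
  \<comment> \<open>Successive approximation: the error magnified by \<open>2^n\<close> lies in
    \<open>M \<subseteq> U\<close>, so it can be approximated once more by an element of
    \<open>F\<close>, which enters with the factor \<open>1/2^n\<close>.\<close>
  have approx: "\<exists>f\<in>span F. (2^n) *\<^sub>R (u - f) \<in> M" if "u \<in> M" for u n
  proof (induction n)
    case 0
    show ?case using that by (intro bexI[of _ 0]) (auto intro: span_zero)
  next
    case (Suc n)
    then obtain f where f: "f \<in> span F" "(2^n) *\<^sub>R (u - f) \<in> M" by blast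
    then obtain f' where f': "f' \<in> F" "2 *\<^sub>R ((2^n) *\<^sub>R (u - f) - f') \<in> M" using F(2) M(3) by blast
    have "2 *\<^sub>R ((2^n) *\<^sub>R (u - f) - f') = (2^Suc n) *\<^sub>R (u - (f + (1/2^n) *\<^sub>R f'))"
      by (simp add: algebra_simps)
    then show ?case using f f'
      by (intro bexI[of _ "f + (1/2^n) *\<^sub>R f'"]) (auto intro: span_add span_scale span_base)
  qed
  \<comment> \<open>Errors in \<open>M\<close> scaled by \<open>1/2^n\<close> are small only if
    \<open>M\<close> is bounded in the sense of topological vector spaces. Total boundedness gives
    this: \<open>M\<close> lies in \<open>G + P\<close> with \<open>G\<close> finite, and finitely
    many vectors are absorbed by \<open>P\<close> with a common power of 2.\<close>
  have bounded: "\<exists>n. \<forall>x. (2^n) *\<^sub>R x \<in> M \<longrightarrow> x \<in> N" if N: "open N" "0 \<in> N" for N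
  proof -
    obtain P where P: "open P" "0 \<in> P" "balanced P" "\<forall>a\<in>P. \<forall>b\<in>P. a + b \<in> N \<and> a - b \<in> N"
      by (rule balanced_add_nhd[OF N])
    obtain G where G: "finite G" "\<And>u. u \<in> U \<Longrightarrow> \<exists>f\<in>G. u - f \<in> P" using tb[OF P(1,2)] by blast
    have "\<exists>n. \<forall>f\<in>G. (1/2^n) *\<^sub>R f \<in> P"
      using G(1)
    proof (induction G)
      case (insert f G)
      then obtain n where n: "\<forall>f\<in>G. (1/2^n) *\<^sub>R f \<in> P" by blast
      obtain e where e: "e > 0" "\<And>t::real. \<bar>t\<bar> < e \<Longrightarrow> t *\<^sub>R f \<in> P"
        using eventually_smult_in_nhd[OF P(1,2)] by blast
      obtain m where m: "(1/2)^m < e" using real_arch_pow_inv[OF e(1)] by force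
      have "(1/2^(n+m)) *\<^sub>R x \<in> P" if "x \<in> G" for x
      proof -
        have "(1/2^(n+m)) *\<^sub>R x = (1/2^m) *\<^sub>R ((1/2^n) *\<^sub>R x)" by (simp add: power_add)
        moreover have "(1/2^m) *\<^sub>R ((1/2^n) *\<^sub>R x) \<in> P"
          by (rule balancedD[OF P(3)]) (use n that in auto)
        ultimately show ?thesis by (simp only:)
      qed
      moreover have "(1/2^(n+m)) *\<^sub>R f \<in> P"
      proof (rule e(2))
        have "\<bar>1/2^(n+m)\<bar> \<le> ((1/2)^m :: real)" by (simp add: power_add field_simps)
        then show "\<bar>1/2^(n+m)\<bar> < e" using m by linarith
      qed
      ultimately show ?case by blast
    qed auto
    then obtain n where n: "\<And>f. f \<in> G \<Longrightarrow> (1/2^n) *\<^sub>R f \<in> P" by blast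
    have "x \<in> N" if x: "(2^n) *\<^sub>R x \<in> M" for x
    proof -
      obtain f where f: "f \<in> G" "(2^n) *\<^sub>R x - f \<in> P" using G(2) x M(3) by blast
      have "(1/2^n) *\<^sub>R ((2^n) *\<^sub>R x - f) \<in> P" using f(2) P(3) unfolding balanced_def by simp
      with P(4) n[OF f(1)] have "(1/2^n) *\<^sub>R f + (1/2^n) *\<^sub>R ((2^n) *\<^sub>R x - f) \<in> N" by blast
      then show ?thesis by (simp add: algebra_simps)
    qed
    then show ?thesis by blast
  qed
  have "M \<subseteq> span F"
  proof
    fix u assume u: "u \<in> M"
    have "u \<in> closure (span F)"
      unfolding closure_iff_nhds_not_empty
    proof (intro allI impI)
      fix A N assume "N \<subseteq> A" "open N" "u \<in> N"
      have "continuous_on UNIV (\<lambda>x. u + (-1) *\<^sub>R x)"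
        by (intro continuous_on_plus continuous_on_smult continuous_intros)
      from open_vimage[OF \<open>open N\<close> this] have "open {x. u - x \<in> N}" by (simp add: vimage_def)
      then obtain n where n: "\<And>x. (2^n) *\<^sub>R x \<in> M \<Longrightarrow> u - x \<in> N"
        using bounded[of "{x. u - x \<in> N}"] \<open>u \<in> N\<close> by auto
      obtain f where "f \<in> span F" "(2^n) *\<^sub>R (u - f) \<in> M" using approx[OF u] by blast
      then show "span F \<inter> A \<noteq> {}" using n[of "u - f"] \<open>N \<subseteq> A\<close> by auto
    qed
    then show "u \<in> span F" using closed_finite_span[OF F(1)] by simp
  qed
  have "x \<in> span F" for x
  proof -
    obtain e where e: "e > 0" "\<And>t::real. \<bar>t\<bar> < e \<Longrightarrow> t *\<^sub>R x \<in> M"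
      using eventually_smult_in_nhd[OF M(1,2)] by blast
    have "(e/2) *\<^sub>R x \<in> span F" using e \<open>M \<subseteq> span F\<close> by auto
    then have "(2/e) *\<^sub>R ((e/2) *\<^sub>R x) \<in> span F" by (rule span_scale)
    then show ?thesis using e(1) by simp
  qed
  then show False using assms(1) F(1) by (auto simp: finite_dim_space_def)
qed

end

section \<open>The colimit topology\<close>

text \<open>\<open>colim_top\<close> is made with \<open>topology\<close>, so its predicate
  describes the open sets only once it is known to be a topology. All later arguments use this
  pointwise form.\<close>

lemma openin_colim_top:
  fixes W :: "('a \<Rightarrow> 'v::{real_vector,topological_space}) set"
  shows "openin (colim_top X) W \<longleftrightarrow> W \<subseteq> CK_union X \<and>
    (\<forall>K f. compactin X K \<longrightarrow> f \<in> W \<longrightarrow> f \<in> CK X K \<longrightarrow>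
       (\<exists>U. open U \<and> 0 \<in> U \<and> (\<forall>g\<in>CK X K. (\<forall>x\<in>topspace X. g x - f x \<in> U) \<longrightarrow> g \<in> W)))"
    (is "_ \<longleftrightarrow> ?P W")
proof -
  have eq: "(W \<subseteq> CK_union X \<and> (\<forall>K. compactin X K \<longrightarrow> unif_open X (CK X K) (W \<inter> CK X K))) \<longleftrightarrow> ?P W"
    for W :: "('a \<Rightarrow> 'v) set"
  proof (intro conj_cong refl iffI allI impI)
    fix K f assume "\<forall>K. compactin X K \<longrightarrow> unif_open X (CK X K) (W \<inter> CK X K)" "compactin X K"
      and f: "f \<in> W" "f \<in> CK X K"
    then have "unif_open X (CK X K) (W \<inter> CK X K)" by blast
    with f obtain U where "open U" "0 \<in> U" "{g \<in> CK X K. \<forall>x\<in>topspace X. g x - f x \<in> U} \<subseteq> W \<inter> CK X K"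
      unfolding unif_open_def by blast
    then show "\<exists>U. open U \<and> 0 \<in> U \<and> (\<forall>g\<in>CK X K. (\<forall>x\<in>topspace X. g x - f x \<in> U) \<longrightarrow> g \<in> W)"
      by (intro exI[of _ U]) auto
  next
    fix K assume *: "\<forall>K f. compactin X K \<longrightarrow> f \<in> W \<longrightarrow> f \<in> CK X K \<longrightarrow>
       (\<exists>U. open U \<and> 0 \<in> U \<and> (\<forall>g\<in>CK X K. (\<forall>x\<in>topspace X. g x - f x \<in> U) \<longrightarrow> g \<in> W))"
      and K: "compactin X K"
    show "unif_open X (CK X K) (W \<inter> CK X K)"
      unfolding unif_open_def
    proof (intro conjI ballI Int_lower2)
      fix f assume "f \<in> W \<inter> CK X K"
      then obtain U where "open U" "0 \<in> U" "\<forall>g\<in>CK X K. (\<forall>x\<in>topspace X. g x - f x \<in> U) \<longrightarrow> g \<in> W"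
        using * K by blast
      then show "\<exists>U. open U \<and> 0 \<in> U \<and> {g \<in> CK X K. \<forall>x\<in>topspace X. g x - f x \<in> U} \<subseteq> W \<inter> CK X K"
        by (intro exI[of _ U]) auto
    qed
  qed
  have "istopology ?P"
    unfolding istopology_def
  proof (intro conjI allI impI)
    fix A B assume A: "?P A" and B: "?P B"
    show "A \<inter> B \<subseteq> CK_union X" using A by blast
    fix K f assume K: "compactin X K" and f: "f \<in> A \<inter> B" "f \<in> CK X K"
    obtain U where U: "open U" "0 \<in> U" "\<forall>g\<in>CK X K. (\<forall>x\<in>topspace X. g x - f x \<in> U) \<longrightarrow> g \<in> A"
      using A K f by blast
    obtain U' where U': "open U'" "0 \<in> U'" "\<forall>g\<in>CK X K. (\<forall>x\<in>topspace X. g x - f x \<in> U') \<longrightarrow> g \<in> B"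
      using B K f by blast
    show "\<exists>U. open U \<and> 0 \<in> U \<and> (\<forall>g\<in>CK X K. (\<forall>x\<in>topspace X. g x - f x \<in> U) \<longrightarrow> g \<in> A \<inter> B)"
      using U U' by (intro exI[of _ "U \<inter> U'"]) auto
  next
    fix \<A> assume \<A>: "\<forall>A\<in>\<A>. ?P A"
    show "\<Union>\<A> \<subseteq> CK_union X" using \<A> by blast
    fix K f assume K: "compactin X K" and f: "f \<in> \<Union>\<A>" "f \<in> CK X K"
    then obtain A where A: "A \<in> \<A>" "f \<in> A" by blast
    obtain U where "open U" "0 \<in> U" "\<forall>g\<in>CK X K. (\<forall>x\<in>topspace X. g x - f x \<in> U) \<longrightarrow> g \<in> A"
      using conjunct2[OF bspec[OF \<A> A(1)], rule_format, OF K A(2) f(2)] by blast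
    then show "\<exists>U. open U \<and> 0 \<in> U \<and> (\<forall>g\<in>CK X K. (\<forall>x\<in>topspace X. g x - f x \<in> U) \<longrightarrow> g \<in> \<Union>\<A>)"
      using A(1) by blast
  qed
  then show ?thesis unfolding colim_top_def eq by (simp add: topology_inverse')
qed

lemma topspace_colim_top [simp]:
  "topspace (colim_top X :: ('a \<Rightarrow> 'v::{real_vector,topological_space}) topology) = CK_union X"
proof -
  have "openin (colim_top X) (CK_union X :: ('a \<Rightarrow> 'v) set)"
    unfolding openin_colim_top
  proof (intro conjI allI impI order_refl)
    fix K and f :: "'a \<Rightarrow> 'v" assume "compactin X K"
    then show "\<exists>U. open U \<and> 0 \<in> U \<and> (\<forall>g\<in>CK X K. (\<forall>x\<in>topspace X. g x - f x \<in> U) \<longrightarrow> g \<in> CK_union X)"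
      by (intro exI[of _ UNIV]) (auto simp: CK_union_def)
  qed
  then show ?thesis
    by (metis openin_colim_top openin_subset openin_topspace subset_antisym)
qed

section \<open>The groups C_K(X,V) and neighbourhoods of 0 in their union\<close>

lemma CK_zero [simp]: "(\<lambda>x. 0) \<in> CK X K"
  by (simp add: CK_def supp_in_def)

lemma CK_subset_CK_union: "compactin X K \<Longrightarrow> CK X K \<subseteq> CK_union X"
  by (auto simp: CK_union_def)

lemma CK_eq_0: "f \<in> CK X K \<Longrightarrow> x \<notin> K \<Longrightarrow> f x = 0"
  unfolding CK_def supp_in_def
  using closure_of_subset[of "{x \<in> topspace X. f x \<noteq> 0}" X] by blast

lemma CK_mono: "K \<subseteq> L \<Longrightarrow> CK X K \<subseteq> CK X L"
  unfolding CK_def by blast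

text \<open>Necessity draws on ACP only through this: continuity of addition at the pair of zero
  functions.\<close>

lemma CK_ACP_sum_nhd:
  assumes "CK_ACP X TYPE('v::{real_vector,topological_space})"
    "openin (colim_top X) (W :: ('a \<Rightarrow> 'v) set)" "(\<lambda>x. 0) \<in> W"
  obtains U where "openin (colim_top X) U" "(\<lambda>x. 0) \<in> U" "\<forall>f\<in>U. \<forall>g\<in>U. (\<lambda>x. f x + g x) \<in> W"
proof -
  let ?T = "colim_top X :: ('a \<Rightarrow> 'v) topology"
  define S where "S = {p \<in> topspace (prod_topology ?T ?T). (\<lambda>x. fst p x + snd p x) \<in> W}"
  have "continuous_map (prod_topology ?T ?T) ?T (\<lambda>p x. fst p x + snd p x)"
    using assms(1) by (simp add: CK_ACP_def Let_def)
  then have op: "openin (prod_topology ?T ?T) S"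
    unfolding S_def using assms(2) by (rule openin_continuous_map_preimage)
  have "(\<lambda>x. 0) \<in> topspace ?T" using assms(2,3) openin_subset by blast
  then have mem: "((\<lambda>x. 0), (\<lambda>x. 0)) \<in> S" using assms(3) by (simp add: S_def)
  obtain A B where AB: "openin ?T A" "openin ?T B" "(\<lambda>x. 0) \<in> A" "(\<lambda>x. 0) \<in> B" "A \<times> B \<subseteq> S"
    using iffD1[OF openin_prod_topology_alt op, rule_format, OF mem] by blast
  show ?thesis
  proof
    show "openin ?T (A \<inter> B)" using AB by blast
    show "(\<lambda>x. 0) \<in> A \<inter> B" using AB by blast
    show "\<forall>f\<in>A \<inter> B. \<forall>g\<in>A \<inter> B. (\<lambda>x. f x + g x) \<in> W"
    proof (intro ballI)
      fix f g assume "f \<in> A \<inter> B" "g \<in> A \<inter> B"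
      then have "(f, g) \<in> S" using AB(5) by blast
      then show "(\<lambda>x. f x + g x) \<in> W" by (simp add: S_def)
    qed
  qed
qed

lemma colim_top_nhd_zero:
  assumes "openin (colim_top X) U" "(\<lambda>x. 0) \<in> U" "compactin X K"
  obtains N where "open N" "0 \<in> N" "\<forall>g\<in>CK X K. (\<forall>x. g x \<in> N) \<longrightarrow> g \<in> U"
proof -
  have "\<exists>N. open N \<and> 0 \<in> N \<and> (\<forall>g\<in>CK X K. (\<forall>x\<in>topspace X. g x - 0 \<in> N) \<longrightarrow> g \<in> U)"
    using conjunct2[OF iffD1[OF openin_colim_top assms(1)], rule_format, OF assms(3,2) CK_zero] .
  then show ?thesis using that by auto
qed

lemma bump_function:
  assumes "locally_compact_space X" "Hausdorff_space X" "openin X G" "x \<in> G"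
  obtains K and \<phi> :: "'a \<Rightarrow> real"
  where "compactin X K" "K \<subseteq> G" "continuous_map X euclideanreal \<phi>" "\<phi> x = 1"
    "\<And>y. 0 \<le> \<phi> y \<and> \<phi> y \<le> 1" "\<And>y. y \<notin> K \<Longrightarrow> \<phi> y = 0"
proof -
  have "neighbourhood_base_of (compactin X) X"
    using assms locally_compact_space_neighbourhood_base by blast
  then obtain U K where UK: "openin X U" "compactin X K" "x \<in> U" "U \<subseteq> K" "K \<subseteq> G"
    using assms(3,4) unfolding neighbourhood_base_of by metis
  have "completely_regular_space X"
    using assms locally_compact_regular_imp_completely_regular_space by blast
  moreover have "closedin X (topspace X - U)" "x \<in> topspace X - (topspace X - U)"
    using UK openin_subset[OF UK(1)] by auto
  ultimately obtain f :: "'a \<Rightarrow> real" where f: "continuous_map X (top_of_set {0..1}) f" "f x = 0"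
    "f ` (topspace X - U) \<subseteq> {1}"
    unfolding completely_regular_space_def by blast
  \<comment> \<open>Off the carrier \<open>f\<close> is arbitrary; the value 0 there makes the
    bounds and the vanishing outside \<open>K\<close> hold for every point of the type.\<close>
  let ?\<phi> = "\<lambda>y. if y \<in> topspace X then 1 - f y else 0"
  show ?thesis
  proof
    show "compactin X K" "K \<subseteq> G" by fact+
    have "continuous_map X euclideanreal (\<lambda>y. 1 - f y)"
      using f(1) by (intro continuous_intros) (simp add: continuous_map_in_subtopology)
    then show "continuous_map X euclideanreal ?\<phi>" by (rule continuous_map_eq) simp
    show "?\<phi> x = 1" using f(2) UK(3) openin_subset[OF UK(1)] by auto
    show "0 \<le> ?\<phi> y \<and> ?\<phi> y \<le> 1" for y
      using f(1) by (auto simp: continuous_map_in_subtopology)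
    show "?\<phi> y = 0" if "y \<notin> K" for y using f(3) UK(4) that by auto
  qed
qed

context hausdorff_tvs
begin

lemma smult_in_CK:
  assumes "Hausdorff_space X" "compactin X K" "continuous_map X euclideanreal \<phi>"
    "\<And>y. y \<notin> K \<Longrightarrow> \<phi> y = 0"
  shows "(\<lambda>x. \<phi> x *\<^sub>R (v::'v)) \<in> CK X K"
proof -
  have "continuous_map euclidean euclidean (\<lambda>t::real. t *\<^sub>R v)"
    by (simp, intro continuous_on_smult continuous_intros)
  from continuous_map_compose[OF assms(3) this]
  have "continuous_map X euclidean (\<lambda>x. \<phi> x *\<^sub>R v)" by (simp add: o_def)
  moreover have "supp_in X (\<lambda>x. \<phi> x *\<^sub>R v) \<subseteq> K"
    unfolding supp_in_def using assms
    by (intro closure_of_minimal compactin_imp_closedin) auto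
  moreover have "\<phi> x *\<^sub>R v = 0" if "x \<notin> topspace X" for x
    using assms(2,4) that compactin_subset_topspace by fastforce
  ultimately show ?thesis by (simp add: CK_def)
qed

text \<open>Finite sets of functions are closed for uniform convergence: each member differs from
  \<open>f\<close> at some point, and the resulting neighbourhoods are intersected. The vanishing
  off \<open>S\<close> places that point in \<open>S\<close>.\<close>

lemma nhd_avoiding_finite:
  fixes f :: "'a \<Rightarrow> 'v"
  assumes "finite F" "f \<notin> F"
    and "\<And>g x. g \<in> insert f F \<Longrightarrow> x \<notin> S \<Longrightarrow> g x = 0"
  shows "\<exists>U. open U \<and> 0 \<in> U \<and> (\<forall>g\<in>F. \<exists>x\<in>S. g x - f x \<notin> U)"
  using assms
proof (induction F)
  case empty
  show ?case by (intro exI[of _ UNIV]) auto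
next
  case (insert g F)
  then obtain U where U: "open U" "0 \<in> U" "\<forall>g\<in>F. \<exists>x\<in>S. g x - f x \<notin> U"
    using insert.IH insert.prems by (metis insert_iff)
  obtain x where x: "g x \<noteq> f x" using insert.prems(1) by (metis ext insertI1)
  then have xS: "x \<in> S" using insert.prems(2)[of g x] insert.prems(2)[of f x] by force
  have "g x - f x \<noteq> 0" using x by simp
  then obtain U' where "open U'" "0 \<in> U'" "g x - f x \<notin> U'" by (rule nhd_avoiding)
  then show ?case using U xS by (intro exI[of _ "U \<inter> U'"]) auto
qed

text \<open>Yamasaki's argument. The sequences \<open>a n\<close> are uniformly discrete and shrink to 0 as \<open>n\<close> grows,
  while the bumps \<open>b n k\<close> at points \<open>p n\<close> escaping every compact set shrink to 0 as \<open>k\<close> grows.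
  The sums \<open>a n k + b n k\<close> therefore form a set that is closed in the colimit and misses 0, but
  meets U + U for every neighbourhood U of 0.\<close>
lemma not_CK_ACP_if_separated:
  fixes a :: "nat \<Rightarrow> nat \<Rightarrow> 'a \<Rightarrow> 'v" and h :: "'a \<Rightarrow> real"
  assumes X: "locally_compact_space X" "Hausdorff_space X"
    and h: "continuous_map X euclideanreal h" "\<not> bounded (h ` topspace X)"
    and L: "compactin X L"
    and N: "\<And>U. open U \<Longrightarrow> 0 \<in> U \<Longrightarrow> \<exists>n. N n \<subseteq> U"
    and a: "\<And>n k. a n k \<in> CK X L" "\<And>n k x. a n k x \<in> N n"
    and sep: "\<And>n. \<exists>U. open U \<and> 0 \<in> U \<and> (\<forall>j k. j < k \<longrightarrow> (\<exists>x\<in>topspace X. a n k x - a n j x \<notin> U))"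
    and v: "(v::'v) \<noteq> 0"
  shows "\<not> CK_ACP X TYPE('v)"
proof
  assume acp: "CK_ACP X TYPE('v)"
  have bdd: "\<exists>m. \<forall>x\<in>K. \<bar>h x\<bar> \<le> real m" if "compactin X K" for K
  proof -
    have "bounded (h ` K)"
      using image_compactin[OF that h(1)] compact_imp_bounded by auto
    then obtain r where "\<forall>x\<in>K. \<bar>h x\<bar> \<le> r" unfolding bounded_iff by auto
    then show ?thesis by (meson order_trans real_arch_simple)
  qed
  obtain l where l: "\<And>x. x \<in> L \<Longrightarrow> \<bar>h x\<bar> \<le> real l" using bdd[OF L] by blast
  \<comment> \<open>The summand \<open>n\<close> drives the points out of every compact set, the
    summand \<open>l\<close> keeps them all outside \<open>L\<close>.\<close>
  have "\<exists>x\<in>topspace X. \<bar>h x\<bar> > real (n + l)" for n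
    using h(2) unfolding bounded_iff by (auto simp: not_le)
  then obtain p where p: "\<And>n. p n \<in> topspace X" "\<And>n. \<bar>h (p n)\<bar> > real (n + l)" by metis
  have pL: "p n \<in> topspace X - L" for n using p[of n] l[of "p n"] by force
  have "openin X (topspace X - L)" using X(2) L compactin_imp_closedin by blast
  then have "\<exists>K \<psi>. compactin X K \<and> K \<subseteq> topspace X - L \<and> continuous_map X euclideanreal \<psi> \<and> \<psi> (p n) = (1::real) \<and>
    (\<forall>y. 0 \<le> \<psi> y \<and> \<psi> y \<le> 1) \<and> (\<forall>y. y \<notin> K \<longrightarrow> \<psi> y = 0)" for n
    using bump_function[OF X _ pL[of n]] by metis
  then obtain K \<psi> where K: "\<And>n. compactin X (K n)" "\<And>n. K n \<subseteq> topspace X - L"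
    and \<psi>: "\<And>n. continuous_map X euclideanreal (\<psi> n)" "\<And>n. \<psi> n (p n) = (1::real)"
    "\<And>n y. 0 \<le> \<psi> n y" "\<And>n y. \<psi> n y \<le> 1" "\<And>n y. y \<notin> K n \<Longrightarrow> \<psi> n y = 0" by metis
  define b where "b n k = (\<lambda>x. \<psi> n x *\<^sub>R ((1 / real (Suc k)) *\<^sub>R v))" for n k
  have bK: "b n k \<in> CK X (K n)" for n k
    unfolding b_def by (intro smult_in_CK X K \<psi>)
  \<comment> \<open>The two summands do not interfere: on \<open>L\<close> the sum is
    \<open>a n k\<close>, which preserves the separation in \<open>k\<close>; at \<open>p n\<close>
    it is a nonzero multiple of \<open>v\<close>, which forces \<open>p n\<close> into every compact
    set carrying \<open>d n k\<close>.\<close>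
  define d where "d n k = (\<lambda>x. a n k x + b n k x)" for n k
  have dL: "d n k x = a n k x" if "x \<in> L" for n k x
    unfolding d_def b_def using \<psi>(5)[of x n] K(2)[of n] that by auto
  have dp: "d n k (p n) \<noteq> 0" for n k
    unfolding d_def b_def using CK_eq_0[OF a(1)] pL[of n] v by (auto simp: \<psi>(2))
  have d_out: "d n k x = 0" if "x \<notin> topspace X" for n k x
    using a(1)[of n k] bK[of n k] that unfolding d_def by (simp add: CK_def)
  define W where "W = CK_union X - {d n k | n k. True}"
  have "openin (colim_top X) W"
    unfolding openin_colim_top
  proof (intro conjI allI impI)
    show "W \<subseteq> CK_union X" by (auto simp: W_def)
    fix C f assume C: "compactin X C" and f: "f \<in> W" "f \<in> CK X C"
    obtain m where m: "\<And>x. x \<in> C \<Longrightarrow> \<bar>h x\<bar> \<le> real m" using bdd[OF C] by blast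
    \<comment> \<open>Only finitely many \<open>n\<close> matter on \<open>C\<close>, so finitely
      many neighbourhoods will have to be intersected.\<close>
    have nm: "n < m" if "d n k \<in> CK X C" for n k
    proof -
      have "p n \<in> C" using CK_eq_0[OF that] dp by blast
      then show ?thesis using m[of "p n"] p(2)[of n] by simp
    qed
    \<comment> \<open>For fixed \<open>n\<close>, two sums that are \<open>P\<close>-close to
      \<open>f\<close> would have \<open>Q\<close>-close restrictions to \<open>L\<close>, against
      separation. Hence at most one \<open>k\<close> survives, and it is excluded as a member of a
      finite set not containing \<open>f\<close>.\<close>
    have each: "\<exists>U. open U \<and> 0 \<in> U \<and> (\<forall>k. \<exists>x\<in>topspace X. d n k x - f x \<notin> U)" for n
    proof -
      obtain Q where Q: "open Q" "0 \<in> Q" "\<And>j k. j < k \<Longrightarrow> \<exists>x\<in>topspace X. a n k x - a n j x \<notin> Q"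
        using sep by blast
      obtain P where P: "open P" "0 \<in> P" "balanced P" "\<forall>a\<in>P. \<forall>b\<in>P. a + b \<in> Q \<and> a - b \<in> Q"
        by (rule balanced_add_nhd[OF Q(1,2)])
      define G where "G = {k. \<forall>x\<in>topspace X. d n k x - f x \<in> P}"
      have no: False if jk: "j \<in> G" "k \<in> G" "j < k" for j k
      proof -
        obtain x where x: "x \<in> topspace X" "a n k x - a n j x \<notin> Q" using Q(3)[OF jk(3)] by blast
        have "x \<in> L" using x(2) Q(2) CK_eq_0[OF a(1), of x] by (metis diff_self)
        then have "a n k x - a n j x = (d n k x - f x) - (d n j x - f x)" by (simp add: dL)
        then show False using x P(4) jk unfolding G_def by fastforce
      qed
      have "finite G"
      proof (rule ccontr)
        assume "infinite G"
        then obtain j where "j \<in> G" by fastforce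
        moreover obtain k where "k \<in> G" "j < k" using \<open>infinite G\<close> by (meson infinite_nat_iff_unbounded)
        ultimately show False using no by blast
      qed
      then have "finite (d n ` G)" by simp
      moreover have "f \<notin> d n ` G" using f(1) by (auto simp: W_def)
      moreover have "g x = 0" if "g \<in> insert f (d n ` G)" "x \<notin> topspace X" for g x
        using that d_out f(2) by (auto simp: CK_def)
      ultimately have "\<exists>U. open U \<and> 0 \<in> U \<and> (\<forall>g\<in>d n ` G. \<exists>x\<in>topspace X. g x - f x \<notin> U)"
        by (rule nhd_avoiding_finite)
      then obtain U where U: "open U" "0 \<in> U" "\<forall>g\<in>d n ` G. \<exists>x\<in>topspace X. g x - f x \<notin> U" by blast
      show ?thesis
        using U P(1,2) by (intro exI[of _ "U \<inter> P"]) (auto simp: G_def)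
    qed
    then obtain U where U: "\<And>n. open (U n)" "\<And>n. 0 \<in> U n" "\<And>n k. \<exists>x\<in>topspace X. d n k x - f x \<notin> U n"
      by metis
    show "\<exists>U. open U \<and> 0 \<in> U \<and> (\<forall>g\<in>CK X C. (\<forall>x\<in>topspace X. g x - f x \<in> U) \<longrightarrow> g \<in> W)"
    proof (intro exI[of _ "\<Inter>n<m. U n"] conjI ballI impI)
      show "open (\<Inter>n<m. U n)" using U(1) by blast
      show "0 \<in> (\<Inter>n<m. U n)" using U(2) by blast
      fix g assume g: "g \<in> CK X C" "\<forall>x\<in>topspace X. g x - f x \<in> (\<Inter>n<m. U n)"
      have "g \<noteq> d n k" for n k
      proof
        assume gd: "g = d n k"
        then have "n < m" using nm g(1) by blast
        then show False using U(3)[of n k] g(2) gd by auto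
      qed
      then show "g \<in> W" using g(1) C by (auto simp: W_def CK_union_def)
    qed
  qed
  moreover have "(\<lambda>x. 0) \<in> W"
  proof -
    have "(\<lambda>x. 0) \<noteq> d n k" for n k using dp by metis
    then show ?thesis using CK_subset_CK_union[OF L] CK_zero unfolding W_def by blast
  qed
  ultimately obtain U where U: "openin (colim_top X) U" "(\<lambda>x. 0) \<in> U"
    "\<forall>f\<in>U. \<forall>g\<in>U. (\<lambda>x. f x + g x) \<in> W"
    by (rule CK_ACP_sum_nhd[OF acp])
  obtain A where A: "open A" "0 \<in> A" "\<forall>g\<in>CK X L. (\<forall>x. g x \<in> A) \<longrightarrow> g \<in> U"
    by (rule colim_top_nhd_zero[OF U(1,2) L])
  obtain n where n: "N n \<subseteq> A" using N[OF A(1,2)] by blast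
  \<comment> \<open>The order of choices matters: \<open>B\<close> depends on the compact set
    \<open>K n\<close>, so \<open>n\<close> is fixed first and smallness of the bump must come from
    \<open>k\<close> alone.\<close>
  obtain B where B: "open B" "0 \<in> B" "\<forall>g\<in>CK X (K n). (\<forall>x. g x \<in> B) \<longrightarrow> g \<in> U"
    by (rule colim_top_nhd_zero[OF U(1,2) K(1)])
  obtain e where e: "e > 0" "\<And>t::real. \<bar>t\<bar> < e \<Longrightarrow> t *\<^sub>R v \<in> B"
    using eventually_smult_in_nhd[OF B(1,2), of v] by blast
  obtain k where k: "1 / real (Suc k) < e" using e(1) nat_approx_posE by blast
  have "a n k \<in> U" using A(3) a n by blast
  moreover have "b n k \<in> U"
  proof (rule B(3)[rule_format, OF bK])
    fix x
    have "\<bar>\<psi> n x * (1 / real (Suc k))\<bar> \<le> 1 / real (Suc k)"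
      using \<psi>(3)[of n x] \<psi>(4)[of n x] by (simp add: abs_mult divide_right_mono)
    then have "\<bar>\<psi> n x * (1 / real (Suc k))\<bar> < e" using k by linarith
    from e(2)[OF this] show "b n k x \<in> B" by (simp add: b_def)
  qed
  ultimately have "d n k \<in> W" unfolding d_def by (rule U(3)[rule_format])
  then show False by (auto simp: W_def)
qed

section \<open>Necessity\<close>

lemma countable_balanced_base:
  assumes "metrizable_space (euclidean :: 'v topology)"
  obtains N :: "nat \<Rightarrow> 'v set"
  where "\<And>n. open (N n)" "\<And>n. 0 \<in> N n" "\<And>n. balanced (N n)" "\<And>U. open U \<Longrightarrow> 0 \<in> U \<Longrightarrow> \<exists>n. N n \<subseteq> U"
proof -
  have "first_countable (euclidean :: 'v topology)"
    using assms by (rule metrizable_imp_first_countable)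
  then obtain \<B> where \<B>: "countable \<B>" "\<And>B. B \<in> \<B> \<Longrightarrow> open B"
    "\<And>U. open U \<Longrightarrow> (0::'v) \<in> U \<Longrightarrow> \<exists>B\<in>\<B>. 0 \<in> B \<and> B \<subseteq> U"
    unfolding first_countable_def by (metis UNIV_I open_openin topspace_euclidean)
  define \<C> where "\<C> = {B \<in> \<B>. 0 \<in> B}"
  have "\<C> \<noteq> {}" using \<B>(3)[of UNIV] by (auto simp: \<C>_def)
  moreover have "countable \<C>" using \<B>(1) by (simp add: \<C>_def)
  ultimately have C: "range (from_nat_into \<C>) = \<C>" by (rule range_from_nat_into)
  define C where "C = from_nat_into \<C>"
  note C = C[folded C_def]
  have "\<exists>N. open N \<and> 0 \<in> N \<and> N \<subseteq> C n \<and> balanced N" for n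
  proof -
    have "C n \<in> \<C>" using C rangeI[of C n] by simp
    then have "open (C n)" "0 \<in> C n" using \<B>(2) by (auto simp: \<C>_def)
    then show ?thesis using balanced_nhd by metis
  qed
  then obtain N where N: "\<And>n. open (N n)" "\<And>n. 0 \<in> N n" "\<And>n. N n \<subseteq> C n" "\<And>n. balanced (N n)"
    by metis
  have "\<exists>n. N n \<subseteq> U" if U: "open U" "0 \<in> U" for U
  proof -
    obtain B where "B \<in> \<C>" "B \<subseteq> U" using \<B>(3)[OF U] by (auto simp: \<C>_def)
    then obtain n where "B = C n" using C by (metis rangeE)
    then show ?thesis using N(3)[of n] \<open>B \<subseteq> U\<close> by blast
  qed
  then show ?thesis by (rule that[OF N(1,2,4)])
qed

text \<open>A single bump \<open>\<phi>\<close> carries a separated sequence of vectors into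
  \<open>CK X L\<close>: separation is read off at \<open>y\<close>, where \<open>\<phi>\<close> is
  1, and elsewhere the values stay in the balanced \<open>N n\<close>.\<close>

lemma CK_ACP_imp_finite_dim:
  assumes X: "locally_compact_space X" "Hausdorff_space X"
    and metr: "metrizable_space (euclidean :: 'v topology)" and v: "(v::'v) \<noteq> 0"
    and npc: "\<not> pseudocompact X" and acp: "CK_ACP X TYPE('v)"
  shows "finite_dim_space V"
proof (rule ccontr)
  assume inf: "\<not> finite_dim_space V"
  obtain h where h: "continuous_map X euclideanreal h" "\<not> bounded (h ` topspace X)"
    using npc by (auto simp: pseudocompact_def)
  then obtain y where y: "y \<in> topspace X" by fastforce
  obtain L \<phi> where L: "compactin X L" "L \<subseteq> topspace X" "continuous_map X euclideanreal \<phi>" "\<phi> y = 1"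
    "\<And>y. 0 \<le> \<phi> y \<and> \<phi> y \<le> 1" "\<And>y. y \<notin> L \<Longrightarrow> \<phi> y = 0"
    by (rule bump_function[OF X openin_topspace y]) metis
  obtain N :: "nat \<Rightarrow> 'v set" where N: "\<And>n. open (N n)" "\<And>n. 0 \<in> N n" "\<And>n. balanced (N n)"
    "\<And>U. open U \<Longrightarrow> 0 \<in> U \<Longrightarrow> \<exists>n. N n \<subseteq> U"
    using countable_balanced_base[OF metr] by metis
  have "\<exists>w U. (\<forall>k::nat. w k \<in> N n) \<and> open U \<and> 0 \<in> U \<and> (\<forall>j k. j < k \<longrightarrow> w k - w j \<notin> U)"
    for n :: nat
    by (rule infinite_dim_separated_sequence[OF inf N(1)[of n] N(2)[of n]], rule exI, rule exI, intro conjI)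
  then obtain w U where w: "\<And>n k::nat. w n k \<in> N n" and U: "\<And>n. open (U n)" "\<And>n. 0 \<in> U n"
    "\<And>n j k. j < k \<Longrightarrow> w n k - w n j \<notin> U n" by metis
  have "\<not> CK_ACP X TYPE('v)"
  proof (rule not_CK_ACP_if_separated[OF X h L(1) N(4) _ _ _ v])
    show "(\<lambda>x. \<phi> x *\<^sub>R w n k) \<in> CK X L" for n k using X L by (intro smult_in_CK)
    show "\<phi> x *\<^sub>R w n k \<in> N n" for n k x using L(5)[of x] w by (intro balancedD[OF N(3)]) auto
    show "\<exists>U. open U \<and> 0 \<in> U \<and>
        (\<forall>j k. j < k \<longrightarrow> (\<exists>x\<in>topspace X. \<phi> x *\<^sub>R w n k - \<phi> x *\<^sub>R w n j \<notin> U))" for n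
      using U y L(4) by (intro exI[of _ "U n"]) (auto intro!: bexI[of _ y])
  qed
  then show False using acp by blast
qed

text \<open>Here one nonzero vector \<open>w n\<close> in each \<open>N n\<close> suffices, and the
  separation comes from the space: near a non-isolated point there are infinitely many points
  \<open>q k\<close> in one compact set, with bumps equal to 1 at \<open>q k\<close> and 0 at all
  earlier points.\<close>

lemma CK_ACP_imp_discrete:
  assumes X: "locally_compact_space X" "Hausdorff_space X"
    and metr: "metrizable_space (euclidean :: 'v topology)" and v: "(v::'v) \<noteq> 0"
    and npc: "\<not> pseudocompact X" and acp: "CK_ACP X TYPE('v)"
  shows "X = discrete_topology (topspace X)"
proof (rule ccontr)
  assume "\<not> ?thesis"
  then obtain y where y: "y \<in> topspace X" "\<not> openin X {y}"
    by (metis discrete_topology_unique)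
  obtain h where h: "continuous_map X euclideanreal h" "\<not> bounded (h ` topspace X)"
    using npc by (auto simp: pseudocompact_def)
  obtain G L where GL: "openin X G" "compactin X L" "y \<in> G" "G \<subseteq> L"
    using X(1) y(1) unfolding locally_compact_space_def by blast
  have t1: "openin X (G - F)" if "finite F" for F
  proof -
    have "closedin X (F \<inter> topspace X)"
      using that X(2) by (intro closedin_Hausdorff_finite) auto
    then have "openin X (G - F \<inter> topspace X)" using GL(1) by blast
    moreover have "G - F \<inter> topspace X = G - F" using openin_subset[OF GL(1)] by blast
    ultimately show ?thesis by simp
  qed
  \<comment> \<open>In a Hausdorff space a finite open set has only isolated points.\<close>
  have "infinite G"
  proof
    assume "finite G"
    then have "openin X (G - (G - {y}))" by (intro t1) auto
    moreover have "G - (G - {y}) = {y}" using GL(3) by blast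
    ultimately show False using y(2) by simp
  qed
  then obtain q :: "nat \<Rightarrow> 'a" where q: "inj q" "range q \<subseteq> G" using infinite_countable_subset by blast
  have "q k \<in> G - q ` {..<k}" for k using q by (auto dest: injD)
  then have "\<exists>K \<phi>. compactin X K \<and> K \<subseteq> G - q ` {..<k} \<and> continuous_map X euclideanreal \<phi> \<and> \<phi> (q k) = (1::real) \<and>
    (\<forall>y. 0 \<le> \<phi> y \<and> \<phi> y \<le> 1) \<and> (\<forall>y. y \<notin> K \<longrightarrow> \<phi> y = 0)" for k
    using bump_function[OF X t1[of "q ` {..<k}"], of "q k"] by (metis finite_imageI finite_lessThan)
  then obtain K \<phi> where K: "\<And>k. compactin X (K k)" "\<And>k. K k \<subseteq> G - q ` {..<k}"
    and \<phi>: "\<And>k. continuous_map X euclideanreal (\<phi> k)" "\<And>k. \<phi> k (q k) = (1::real)"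
    "\<And>k y. 0 \<le> \<phi> k y" "\<And>k y. \<phi> k y \<le> 1" "\<And>k y. y \<notin> K k \<Longrightarrow> \<phi> k y = 0" by metis
  obtain N :: "nat \<Rightarrow> 'v set" where N: "\<And>n. open (N n)" "\<And>n. 0 \<in> N n" "\<And>n. balanced (N n)"
    "\<And>U. open U \<Longrightarrow> 0 \<in> U \<Longrightarrow> \<exists>n. N n \<subseteq> U"
    using countable_balanced_base[OF metr] by metis
  have "\<exists>w\<in>N n. w \<noteq> 0" for n
  proof -
    obtain c where "c > 0" "\<And>t::real. \<bar>t\<bar> < c \<Longrightarrow> t *\<^sub>R v \<in> N n"
      using eventually_smult_in_nhd[OF N(1,2)] by blast
    then show ?thesis using v by (intro bexI[of _ "(c/2) *\<^sub>R v"]) auto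
  qed
  then obtain w where w: "\<And>n. w n \<in> N n" "\<And>n. w n \<noteq> 0" by metis
  have "\<not> CK_ACP X TYPE('v)"
  proof (rule not_CK_ACP_if_separated[OF X h GL(2) N(4) _ _ _ v])
    show "(\<lambda>x. \<phi> k x *\<^sub>R w n) \<in> CK X L" for n k
    proof -
      have "(\<lambda>x. \<phi> k x *\<^sub>R w n) \<in> CK X (K k)" using X K \<phi> by (intro smult_in_CK)
      moreover have "K k \<subseteq> L" using K(2) GL(4) by blast
      ultimately show ?thesis using CK_mono by blast
    qed
    show "\<phi> k x *\<^sub>R w n \<in> N n" for n k x using \<phi>(3,4)[of k x] w by (intro balancedD[OF N(3)]) auto
    fix n
    \<comment> \<open>At \<open>q j\<close> the bump with index \<open>j\<close> is 1 and every
      later one is 0, so the difference of the two functions there is exactly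
      \<open>- w n\<close>.\<close>
    have "- w n \<noteq> 0" using w by simp
    then obtain U where U: "open U" "0 \<in> U" "- w n \<notin> U" by (rule nhd_avoiding)
    have "\<exists>x\<in>topspace X. \<phi> k x *\<^sub>R w n - \<phi> j x *\<^sub>R w n \<notin> U" if "j < k" for j k
    proof (rule bexI[of _ "q j"])
      have "\<phi> k (q j) = 0" using \<phi>(5) K(2)[of k] that by blast
      then show "\<phi> k (q j) *\<^sub>R w n - \<phi> j (q j) *\<^sub>R w n \<notin> U" using U(3) \<phi>(2) by simp
      show "q j \<in> topspace X" using q(2) openin_subset[OF GL(1)] by blast
    qed
    then show "\<exists>U. open U \<and> 0 \<in> U \<and>
        (\<forall>j k. j < k \<longrightarrow> (\<exists>x\<in>topspace X. \<phi> k x *\<^sub>R w n - \<phi> j x *\<^sub>R w n \<notin> U))" using U by blast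
  qed
  then show False using acp by blast
qed

end

section \<open>Uncountable discrete spaces\<close>

lemma CK_discrete:
  assumes "K \<subseteq> S" shows "CK (discrete_topology S) K = {f. \<forall>x. x \<notin> K \<longrightarrow> f x = 0}"
  using assms by (auto simp: CK_def supp_in_def discrete_topology_closure_of)

text \<open>Cardinals are comparable: either \<open>S\<close> embeds into the reals, or the reals
  embed into \<open>S\<close> and their image serves as \<open>Z\<close>. The numbers
  \<open>g y\<close> will supply small nonzero distances between points.\<close>

lemma uncountable_subset_inj_real:
  assumes "uncountable (S :: 'a set)"
  obtains Z and g :: "'a \<Rightarrow> real" where "Z \<subseteq> S" "uncountable Z" "inj_on g Z"
proof -
  consider g :: "'a \<Rightarrow> real" where "inj_on g S" | f :: "real \<Rightarrow> 'a" where "range f \<subseteq> S" "inj f"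
    using ordLeq_total[OF card_of_Well_order[of S] card_of_Well_order[of "UNIV :: real set"]]
    by (metis card_of_ordLeq)
  then show ?thesis
  proof cases
    case 1
    then show ?thesis using that assms by blast
  next
    case 2
    then have "uncountable (range f)" using uncountable_UNIV_real countable_image_inj_on by blast
    moreover have "inj_on (inv f) (range f)" by (simp add: inj_on_inv_into)
    ultimately show ?thesis using that 2(1) by blast
  qed
qed

text \<open>Pigeonhole: the half-open intervals of length \<open>e\<close> starting at multiples of
  \<open>e\<close> are countably many, so one of them receives two values.\<close>

lemma uncountable_reals_close:
  fixes g :: "'a \<Rightarrow> real"
  assumes "uncountable Z" "inj_on g Z" "e > 0"
  obtains y z where "y \<in> Z" "z \<in> Z" "y \<noteq> z" "\<bar>g y - g z\<bar> < e"
proof -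
  have "\<not> inj_on (\<lambda>y. \<lfloor>g y / e\<rfloor>) Z"
    using assms(1) countableI'[of "\<lambda>y. \<lfloor>g y / e\<rfloor>" Z] countable_image_inj_on[of "\<lambda>y. \<lfloor>g y / e\<rfloor>" Z] by auto
  then obtain y z where yz: "y \<in> Z" "z \<in> Z" "y \<noteq> z" "\<lfloor>g y / e\<rfloor> = \<lfloor>g z / e\<rfloor>"
    by (auto simp: inj_on_def)
  then have "\<bar>g y / e - g z / e\<bar> < 1" by linarith
  then have "\<bar>g y - g z\<bar> < e" using assms(3) by (simp flip: diff_divide_distrib add: abs_divide)
  then show ?thesis using that yz by blast
qed

context hausdorff_tvs
begin

text \<open>Identify an uncountable part Z of the space with a set of reals by g. The functions with value
  |g y - g z| v at y and z form a closed set, since only finitely many live on a finite set. But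
  uncountably many axes lie in a neighbourhood U of 0 up to the same height, and two of them are
  closer to each other than this height, so U + U meets the set.\<close>
lemma CK_ACP_imp_countable:
  assumes v: "(v::'v) \<noteq> 0" and acp: "CK_ACP (discrete_topology S) TYPE('v)"
  shows "countable S"
proof (rule ccontr)
  let ?X = "discrete_topology S"
  assume "uncountable S"
  then obtain Z g where Z: "Z \<subseteq> S" "uncountable Z" "inj_on (g :: _ \<Rightarrow> real) Z"
    by (rule uncountable_subset_inj_real)
  define d where "d y z = (\<lambda>x. if x = y \<or> x = z then \<bar>g y - g z\<bar> *\<^sub>R v else 0)" for y z
  define D where "D = {d y z | y z. y \<in> Z \<and> z \<in> Z \<and> y \<noteq> z}"
  define W where "W = CK_union ?X - D"
  \<comment> \<open>Injectivity of \<open>g\<close> makes both values nonzero. Hence a member of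
    \<open>D\<close> carried by \<open>K\<close> has both its points in \<open>K\<close>, and the
    zero function is not in \<open>D\<close>.\<close>
  have d_nz: "d y z y \<noteq> 0" "d y z z \<noteq> 0" if "y \<in> Z" "z \<in> Z" "y \<noteq> z" for y z
    using that v Z(3) by (auto simp: d_def inj_on_def)
  have "openin (colim_top ?X) W"
    unfolding openin_colim_top
  proof (intro conjI allI impI)
    show "W \<subseteq> CK_union ?X" by (auto simp: W_def)
    fix K f assume K: "compactin ?X K" and f: "f \<in> W" "f \<in> CK ?X K"
    then have K': "K \<subseteq> S" "finite K" by (auto simp: compactin_discrete_topology)
    have "D \<inter> CK ?X K \<subseteq> (\<lambda>(y, z). d y z) ` (K \<times> K)"
    proof
      fix e assume e: "e \<in> D \<inter> CK ?X K"
      then obtain y z where yz: "e = d y z" "y \<in> Z" "z \<in> Z" "y \<noteq> z" by (auto simp: D_def)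
      then have "y \<in> K" "z \<in> K" using d_nz[OF yz(2-4)] e CK_eq_0[of e ?X K] by auto
      then show "e \<in> (\<lambda>(y, z). d y z) ` (K \<times> K)" using yz(1) by auto
    qed
    then have "finite (D \<inter> CK ?X K)" using K'(2) finite_subset by blast
    moreover have "f \<notin> D \<inter> CK ?X K" using f by (auto simp: W_def)
    moreover have "g x = 0" if "g \<in> insert f (D \<inter> CK ?X K)" "x \<notin> S" for g x
      using that f(2) by (auto simp: CK_def)
    ultimately have "\<exists>U. open U \<and> 0 \<in> U \<and> (\<forall>g\<in>D \<inter> CK ?X K. \<exists>x\<in>S. g x - f x \<notin> U)"
      by (rule nhd_avoiding_finite)
    then obtain U where U: "open U" "0 \<in> U" "\<forall>g\<in>D \<inter> CK ?X K. \<exists>x\<in>S. g x - f x \<notin> U" by blast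
    show "\<exists>U. open U \<and> 0 \<in> U \<and> (\<forall>g\<in>CK ?X K. (\<forall>x\<in>topspace ?X. g x - f x \<in> U) \<longrightarrow> g \<in> W)"
    proof (intro exI[of _ U] conjI U ballI impI)
      fix g assume g: "g \<in> CK ?X K" "\<forall>x\<in>topspace ?X. g x - f x \<in> U"
      then have "g \<notin> D" using U(3) by auto
      then show "g \<in> W" using g(1) K CK_subset_CK_union by (auto simp: W_def)
    qed
  qed
  moreover have "(\<lambda>x. 0) \<in> W"
  proof -
    have "(\<lambda>x. 0) \<notin> D"
    proof
      assume "(\<lambda>x. 0) \<in> D"
      then obtain y z where "y \<in> Z" "z \<in> Z" "y \<noteq> z" "(\<lambda>x. 0) = d y z" by (auto simp: D_def)
      then show False using d_nz(1)[of y z] by metis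
    qed
    then show ?thesis using CK_subset_CK_union[of ?X "{}"] CK_zero[of ?X "{}"] by (auto simp: W_def)
  qed
  ultimately obtain U where U: "openin (colim_top ?X) U" "(\<lambda>x. 0) \<in> U"
    "\<forall>f\<in>U. \<forall>g\<in>U. (\<lambda>x. f x + g x) \<in> W"
    by (rule CK_ACP_sum_nhd[OF acp])
  have "\<exists>n. \<forall>t. \<bar>t\<bar> < 1 / real (Suc n) \<longrightarrow> (\<lambda>x. if x = y then t *\<^sub>R v else 0) \<in> U" if y: "y \<in> S" for y
  proof -
    have "compactin ?X {y}" using y by (simp add: compactin_discrete_topology)
    then obtain N where N: "open N" "0 \<in> N" "\<forall>g\<in>CK ?X {y}. (\<forall>x. g x \<in> N) \<longrightarrow> g \<in> U"
      by (rule colim_top_nhd_zero[OF U(1,2)])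
    obtain c where c: "c > 0" "\<And>t::real. \<bar>t\<bar> < c \<Longrightarrow> t *\<^sub>R v \<in> N"
      using eventually_smult_in_nhd[OF N(1,2)] by blast
    obtain n where n: "1 / real (Suc n) < c" using c(1) nat_approx_posE by blast
    have "(\<lambda>x. if x = y then t *\<^sub>R v else 0) \<in> U" if "\<bar>t\<bar> < 1 / real (Suc n)" for t
      using that n c(2)[of t] N(2) y by (intro N(3)[rule_format]) (auto simp: CK_discrete)
    then show ?thesis by blast
  qed
  then obtain n where n: "\<And>y t. y \<in> S \<Longrightarrow> \<bar>t\<bar> < 1 / real (Suc (n y)) \<Longrightarrow> (\<lambda>x. if x = y then t *\<^sub>R v else 0) \<in> U"
    by metis
  obtain m where m: "uncountable {y \<in> Z. n y = m}"
  proof (rule ccontr)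
    assume "\<not> thesis"
    then have "countable {y \<in> Z. n y = m}" for m using that by blast
    then have "countable (\<Union>m. {y \<in> Z. n y = m})" by blast
    moreover have "(\<Union>m. {y \<in> Z. n y = m}) = Z" by blast
    ultimately show False using Z(2) by simp
  qed
  have "inj_on g {y \<in> Z. n y = m}" using Z(3) by (auto simp: inj_on_def)
  then obtain y z where yz: "y \<in> {y \<in> Z. n y = m}" "z \<in> {y \<in> Z. n y = m}" "y \<noteq> z"
    "\<bar>g y - g z\<bar> < 1 / real (Suc m)"
    using uncountable_reals_close[OF m, of g "1 / real (Suc m)"] by auto
  have "(\<lambda>x. if x = y then \<bar>g y - g z\<bar> *\<^sub>R v else 0) \<in> U" "(\<lambda>x. if x = z then \<bar>g y - g z\<bar> *\<^sub>R v else 0) \<in> U"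
    using yz Z(1) by (auto intro!: n)
  then have "(\<lambda>x. (if x = y then \<bar>g y - g z\<bar> *\<^sub>R v else 0) + (if x = z then \<bar>g y - g z\<bar> *\<^sub>R v else 0)) \<in> W"
    by (rule U(3)[rule_format])
  moreover have "(\<lambda>x. (if x = y then \<bar>g y - g z\<bar> *\<^sub>R v else 0) + (if x = z then \<bar>g y - g z\<bar> *\<^sub>R v else 0)) = d y z"
    using yz(3) by (auto simp: d_def)
  ultimately show False using yz by (auto simp: W_def D_def)
qed

end

section \<open>Sufficiency\<close>

context hausdorff_tvs
begin

lemma open_coordinate_nhd:
  assumes "finite K" "open (U :: 'v set)"
  shows "open {c :: 'a \<Rightarrow> 'v. \<forall>x\<in>K. c x - b x \<in> U}"
proof -
  have "open ((\<lambda>c. c x) -` {y. y - b x \<in> U})" for x :: 'a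
    by (rule open_vimage[OF open_translation_vimage[OF assms(2)] continuous_on_product_coordinates])
  then have "open (\<Inter>x\<in>K. (\<lambda>c. c x) -` {y. y - b x \<in> U})" using assms(1) by blast
  moreover have "(\<Inter>x\<in>K. (\<lambda>c. c x) -` {y. y - b x \<in> U}) = {c. \<forall>x\<in>K. c x - b x \<in> U}" by auto
  ultimately show ?thesis by simp
qed

text \<open>The box is centred at an arbitrary \<open>h\<close>, so that boxes describe
  neighbourhoods of every point without a prior translation to 0.\<close>

definition shifted_box :: "('a \<Rightarrow> 'v) \<Rightarrow> ('a \<Rightarrow> 'v set) \<Rightarrow> ('a \<Rightarrow> 'v) set" where
  "shifted_box h B = {g. \<forall>x. g x - h x \<in> B x}"

text \<open>One step of the tube argument. All functions involved live on one finite set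
  \<open>K\<close>, where \<open>W\<close> has a uniform neighbourhood around each point of the box.
  By compactness finitely many of these cover the box, so their intersection bounds the new
  coordinate; finite dimension provides a compact neighbourhood \<open>C\<close> inside it, and the
  enlarged box is compact again.\<close>

lemma extend_compact_box:
  fixes h :: "'a \<Rightarrow> 'v"
  assumes fd: "finite_dim_space V" and W: "openin (colim_top (discrete_topology S)) W"
    and h: "h \<in> W" and B: "\<And>x. compact (B x)" "shifted_box h B \<subseteq> W"
    and F: "finite F" "F \<subseteq> S" "\<And>x. x \<notin> F \<Longrightarrow> B x = {0}" and y: "y \<in> S" "y \<notin> F"
  shows "\<exists>N C. open N \<and> 0 \<in> N \<and> N \<subseteq> C \<and> compact C \<and> shifted_box h (B(y := C)) \<subseteq> W"
proof -
  let ?X = "discrete_topology S"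
  obtain K0 where K0: "finite K0" "K0 \<subseteq> S" "h \<in> CK ?X K0"
    using W h unfolding openin_colim_top by (auto simp: CK_union_def compactin_discrete_topology)
  define K where "K = insert y (K0 \<union> F)"
  have K: "compactin ?X K" "K \<subseteq> S" "finite K"
    using K0 F y by (auto simp: K_def compactin_discrete_topology)
  have h0: "h x = 0" if "x \<notin> K" for x using K0(3) CK_eq_0 that by (fastforce simp: K_def)
  define Q where "Q = {b. \<forall>x. b x \<in> B x}"
  have Q0: "b x = 0" if "b \<in> Q" "x \<notin> F" for b x using that F(3)[of x] by (auto simp: Q_def)
  have "\<forall>b\<in>Q. \<exists>U. open U \<and> 0 \<in> U \<and> (\<forall>g\<in>CK ?X K. (\<forall>x\<in>S. g x - (h x + b x) \<in> U) \<longrightarrow> g \<in> W)"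
  proof
    fix b assume b: "b \<in> Q"
    have "(\<lambda>x. h x + b x) \<in> W" using b B(2) by (auto simp: shifted_box_def Q_def)
    moreover have "(\<lambda>x. h x + b x) \<in> CK ?X K"
      unfolding CK_discrete[OF K(2)] using h0 Q0[OF b] by (simp add: K_def)
    ultimately show "\<exists>U. open U \<and> 0 \<in> U \<and> (\<forall>g\<in>CK ?X K. (\<forall>x\<in>S. g x - (h x + b x) \<in> U) \<longrightarrow> g \<in> W)"
      using conjunct2[OF iffD1[OF openin_colim_top W], rule_format, OF K(1)] by simp
  qed
  from bchoice[OF this] obtain U where "\<forall>b\<in>Q. open (U b) \<and> 0 \<in> U b \<and>
    (\<forall>g\<in>CK ?X K. (\<forall>x\<in>S. g x - (h x + b x) \<in> U b) \<longrightarrow> g \<in> W)" ..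
  then have U: "\<And>b. b \<in> Q \<Longrightarrow> open (U b)" "\<And>b. b \<in> Q \<Longrightarrow> 0 \<in> U b"
    "\<And>b g. b \<in> Q \<Longrightarrow> g \<in> CK ?X K \<Longrightarrow> \<forall>x\<in>S. g x - (h x + b x) \<in> U b \<Longrightarrow> g \<in> W"
    by auto
  have "compact Q" unfolding Q_def using B(1) by (rule compact_function_box)
  moreover have "open {c. \<forall>x\<in>K. c x - b x \<in> U b}" if "b \<in> Q" for b
    using open_coordinate_nhd[OF K(3) U(1)[OF that]] .
  moreover have "Q \<subseteq> (\<Union>b\<in>Q. {c. \<forall>x\<in>K. c x - b x \<in> U b})" using U(2) by auto
  ultimately obtain Q' where Q': "Q' \<subseteq> Q" "finite Q'" "Q \<subseteq> (\<Union>b\<in>Q'. {c. \<forall>x\<in>K. c x - b x \<in> U b})"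
    by (rule compactE_image)
  have "open (\<Inter>b\<in>Q'. U b)" "0 \<in> (\<Inter>b\<in>Q'. U b)" using Q'(1,2) U(1,2) by auto
  then obtain N C where NC: "open N" "0 \<in> N" "N \<subseteq> C" "compact C" "C \<subseteq> (\<Inter>b\<in>Q'. U b)"
    by (rule finite_dim_compact_nhd[OF fd])
  have "g \<in> W" if g: "g \<in> shifted_box h (B(y := C))" for g
  proof -
    have gx: "g x - h x \<in> (B(y := C)) x" for x using g by (simp add: shifted_box_def)
    have gB: "g x - h x \<in> B x" if "x \<noteq> y" for x using gx[of x] that by simp
    have gy: "g y - h y \<in> C" using gx[of y] by simp
    \<comment> \<open>Resetting the new coordinate to 0 returns the displacement to the old box
      \<open>Q\<close>, where the finite cover applies. At \<open>y\<close> itself \<open>b\<close>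
      is 0, and the displacement lies in \<open>C\<close>, hence in every \<open>U b\<close> of the
      finite subcover.\<close>
    define c where "c = (\<lambda>x. if x = y then 0 else g x - h x)"
    have "c \<in> Q" using gB F(3)[OF y(2)] by (auto simp: Q_def c_def)
    then obtain b where b: "b \<in> Q'" "\<forall>x\<in>K. c x - b x \<in> U b" using Q'(3) by blast
    then have bQ: "b \<in> Q" using Q'(1) by blast
    have out: "g x = h x" if "x \<notin> K" for x
      using gB[of x] F(3)[of x] that by (auto simp: K_def)
    show ?thesis
    proof (rule U(3)[OF bQ])
      show "g \<in> CK ?X K" unfolding CK_discrete[OF K(2)] using out h0 by simp
      show "\<forall>x\<in>S. g x - (h x + b x) \<in> U b"
      proof
        fix x assume "x \<in> S"
        consider "x = y" | "x \<in> K" "x \<noteq> y" | "x \<notin> K" by blast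
        then show "g x - (h x + b x) \<in> U b"
        proof cases
          case 1
          then show ?thesis using gy NC(5) b(1) Q0[OF bQ y(2)] by auto
        next
          case 2
          then have "c x - b x \<in> U b" using b(2) by blast
          then show ?thesis using 2 by (simp add: c_def diff_diff_eq)
        next
          case 3
          then show ?thesis using out[OF 3] Q0[OF bQ, of x] U(2)[OF bQ] by (auto simp: K_def)
        qed
      qed
    qed
  qed
  then have "shifted_box h (B(y := C)) \<subseteq> W" by blast
  then show ?thesis using NC(1-4) by blast
qed

text \<open>Coordinates are thickened one by one along the enumeration, and a factor once chosen is
  never changed. A member of the union differs from \<open>h\<close> at finitely many points only,
  so membership in the infinite open box already places it in a compact box of some finite
  stage.\<close>

lemma open_box_inside:
  fixes h :: "'a \<Rightarrow> 'v" and e :: "nat \<Rightarrow> 'a"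
  assumes fd: "finite_dim_space V" and e: "bij_betw e UNIV S"
    and W: "openin (colim_top (discrete_topology S)) W" and h: "h \<in> W"
  shows "\<exists>N. (\<forall>x. open (N x) \<and> 0 \<in> N x) \<and> CK_union (discrete_topology S) \<inter> shifted_box h N \<subseteq> W"
proof -
  let ?X = "discrete_topology S"
  have inj: "inj e" and ran: "range e = S" using e by (auto simp: bij_betw_def)
  \<comment> \<open>Coordinates not yet visited carry \<open>{0}\<close>, so stage 0 is the single
    function \<open>h\<close> and every stage deviates from \<open>h\<close> on a finite
    set.\<close>
  define P where "P = (\<lambda>n B. (\<forall>x. compact (B x)) \<and> (\<forall>x. (0::'v) \<in> B x) \<and>
    (\<forall>x. x \<notin> e ` {..<n} \<longrightarrow> B x = {0}) \<and> shifted_box h B \<subseteq> W)"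
  define R where "R = (\<lambda>n B B'. \<exists>N C. open N \<and> (0::'v) \<in> N \<and> N \<subseteq> C \<and> B' = B(e n := C))"
  have "\<exists>B. \<forall>n. P n (B n) \<and> R n (B n) (B (Suc n))"
  proof (rule dependent_nat_choice)
    have "shifted_box h (\<lambda>x. {0}) = {h}" by (auto simp: shifted_box_def)
    then show "\<exists>B. P 0 B" using h by (intro exI[of _ "\<lambda>x. {0}"]) (auto simp: P_def)
  next
    fix B n assume "P n B"
    then have B: "\<And>x. compact (B x)" "\<And>x. 0 \<in> B x" "\<And>x. x \<notin> e ` {..<n} \<Longrightarrow> B x = {0}"
      "shifted_box h B \<subseteq> W" by (auto simp: P_def)
    have "e n \<in> S" "e n \<notin> e ` {..<n}" "e ` {..<n} \<subseteq> S" using inj ran by (auto dest: injD)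
    then have "\<exists>N C. open N \<and> 0 \<in> N \<and> N \<subseteq> C \<and> compact C \<and> shifted_box h (B(e n := C)) \<subseteq> W"
      by (intro extend_compact_box[OF fd W h B(1,4), of "e ` {..<n}"] B(3)) auto
    then obtain N C where NC: "open N" "0 \<in> N" "N \<subseteq> C" "compact C" "shifted_box h (B(e n := C)) \<subseteq> W"
      by blast
    have "P (Suc n) (B(e n := C))"
      using B NC by (auto simp: P_def lessThan_Suc)
    moreover have "R n B (B(e n := C))" using NC by (auto simp: R_def)
    ultimately show "\<exists>B'. P (Suc n) B' \<and> R n B B'" by blast
  qed
  then obtain B where B: "\<And>n. P n (B n)" "\<And>n. R n (B n) (B (Suc n))" by blast
  obtain N C where NC: "\<And>n. open (N n)" "\<And>n. (0::'v) \<in> N n" "\<And>n. N n \<subseteq> C n"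
    "\<And>n. B (Suc n) = (B n)(e n := C n)"
    using B(2) unfolding R_def by metis
  have BC: "B n (e m) = C m" if "m < n" for m n
    using that
  proof (induction n)
    case (Suc n)
    then show ?case using inj by (auto simp: NC(4) less_Suc_eq dest: injD)
  qed simp
  \<comment> \<open>Functions in the union vanish off \<open>S\<close>, so no restriction is imposed
    there.\<close>
  define M where "M = (\<lambda>x. if x \<in> S then N (inv e x) else UNIV)"
  have "g \<in> W" if g: "g \<in> CK_union ?X" "g \<in> shifted_box h M" for g
  proof -
    have "h \<in> CK_union ?X" using openin_subset[OF W] h by auto
    with g(1) obtain K K' where K: "finite K" "K \<subseteq> S" "g \<in> CK ?X K" "finite K'" "K' \<subseteq> S" "h \<in> CK ?X K'"
      by (auto simp: CK_union_def compactin_discrete_topology)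
    \<comment> \<open>The stage \<open>n\<close> is taken beyond all indices of points in the two
      supports, so that \<open>g\<close> and \<open>h\<close> agree wherever the box still has the
      factor \<open>{0}\<close>.\<close>
    have "finite (e -` (K \<union> K'))" using K inj by (intro finite_vimageI) auto
    then obtain n where n: "e -` (K \<union> K') \<subseteq> {..<n}" using finite_nat_iff_bounded by blast
    have "g x - h x \<in> B n x" for x
    proof (cases "x \<in> e ` {..<n}")
      case True
      then obtain m where m: "x = e m" "m < n" by auto
      then have "M x = N m" using ran inj by (auto simp: M_def)
      then have "g x - h x \<in> N m" using g(2) unfolding shifted_box_def by force
      then show ?thesis using NC(3)[of m] BC[OF m(2)] m(1) by auto
    next
      case False
      have "x \<notin> K \<union> K'"
      proof
        assume "x \<in> K \<union> K'"
        then obtain m where "x = e m" using K(2,5) ran by blast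
        then show False using n False \<open>x \<in> K \<union> K'\<close> by auto
      qed
      then have "g x = 0" "h x = 0" using CK_eq_0[OF K(3)] CK_eq_0[OF K(6)] by simp_all
      then show ?thesis using B(1)[of n] by (simp add: P_def)
    qed
    then show ?thesis using B(1)[of n] by (auto simp: P_def shifted_box_def)
  qed
  moreover have "open (M x)" "0 \<in> M x" for x using NC by (auto simp: M_def)
  ultimately show ?thesis by (intro exI[of _ M]) auto
qed

text \<open>On a fixed \<open>CK\<close> the box imposes conditions at the finitely many points of
  \<open>K\<close> only; off \<open>K\<close> all members agree with \<open>g\<close>, which
  satisfies them already.\<close>

lemma openin_shifted_box:
  fixes f :: "'a \<Rightarrow> 'v"
  assumes "\<And>x. open (N x)"
  shows "openin (colim_top (discrete_topology S)) (CK_union (discrete_topology S) \<inter> shifted_box f N)"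
  unfolding openin_colim_top
proof (intro conjI allI impI Int_lower1)
  let ?X = "discrete_topology S"
  fix K g assume K: "compactin ?X K" and g: "g \<in> CK_union ?X \<inter> shifted_box f N" "g \<in> CK ?X K"
  define U where "U = (\<Inter>x\<in>K. {u. u - (f x - g x) \<in> N x})"
  have "finite K" using K by (simp add: compactin_discrete_topology)
  then have "open U" unfolding U_def using assms by (auto intro: open_translation_vimage)
  moreover have "0 \<in> U" using g(1) by (auto simp: U_def shifted_box_def)
  moreover have "u \<in> CK_union ?X \<inter> shifted_box f N"
    if u: "u \<in> CK ?X K" "\<forall>x\<in>topspace ?X. u x - g x \<in> U" for u
  proof -
    have "u x - f x \<in> N x" for x
    proof (cases "x \<in> K")
      case True
      then have "x \<in> topspace ?X" using compactin_subset_topspace[OF K] by blast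
      then have "u x - g x \<in> U" using u(2) by blast
      then have "u x - g x - (f x - g x) \<in> N x" using True unfolding U_def by blast
      then show ?thesis by simp
    next
      case False
      then have "u x = g x" using CK_eq_0[OF u(1)] CK_eq_0[OF g(2)] by simp
      then show ?thesis using g(1) by (auto simp: shifted_box_def)
    qed
    then show ?thesis using u(1) CK_subset_CK_union[OF K] by (auto simp: shifted_box_def)
  qed
  ultimately show "\<exists>U. open U \<and> 0 \<in> U \<and>
    (\<forall>u\<in>CK ?X K. (\<forall>x\<in>topspace ?X. u x - g x \<in> U) \<longrightarrow> u \<in> CK_union ?X \<inter> shifted_box f N)" by blast
qed

lemma CK_union_discrete:
  "CK_union (discrete_topology S) = {f :: 'a \<Rightarrow> 'v. finite {x. f x \<noteq> 0} \<and> {x. f x \<noteq> 0} \<subseteq> S}"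
proof (intro set_eqI iffI)
  fix f :: "'a \<Rightarrow> 'v" assume "f \<in> CK_union (discrete_topology S)"
  then obtain K where K: "finite K" "K \<subseteq> S" "f \<in> CK (discrete_topology S) K"
    by (auto simp: CK_union_def compactin_discrete_topology)
  then have "{x. f x \<noteq> 0} \<subseteq> K" by (auto simp: CK_discrete)
  then show "f \<in> {f. finite {x. f x \<noteq> 0} \<and> {x. f x \<noteq> 0} \<subseteq> S}" using K finite_subset by auto
next
  fix f :: "'a \<Rightarrow> 'v" assume f: "f \<in> {f. finite {x. f x \<noteq> 0} \<and> {x. f x \<noteq> 0} \<subseteq> S}"
  then have "f \<in> CK (discrete_topology S) {x. f x \<noteq> 0}" by (auto simp: CK_discrete)
  then show "f \<in> CK_union (discrete_topology S)"
    using f CK_subset_CK_union[of "discrete_topology S" "{x. f x \<noteq> 0}"]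
    by (auto simp: compactin_discrete_topology)
qed

text \<open>Since boxes form a neighbourhood base, continuity is checked coordinatewise in
  \<open>V\<close>, with a separate neighbourhood \<open>M x\<close> for each \<open>x\<close> and
  no uniformity among them.\<close>

lemma CK_ACP_countable_discrete:
  fixes e :: "nat \<Rightarrow> 'a"
  assumes fd: "finite_dim_space V" and e: "bij_betw e UNIV S"
  shows "CK_ACP (discrete_topology S) TYPE('v)"
proof -
  let ?X = "discrete_topology S"
  let ?T = "colim_top ?X :: ('a \<Rightarrow> 'v) topology"
  have sum_in: "(\<lambda>x. f x + g x) \<in> CK_union ?X" if "f \<in> CK_union ?X" "g \<in> CK_union ?X" for f g :: "'a \<Rightarrow> 'v"
  proof -
    have "{x. f x + g x \<noteq> 0} \<subseteq> {x. f x \<noteq> 0} \<union> {x. g x \<noteq> 0}" by auto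
    moreover have "finite ({x. f x \<noteq> 0} \<union> {x. g x \<noteq> 0})" "{x. f x \<noteq> 0} \<union> {x. g x \<noteq> 0} \<subseteq> S"
      using that unfolding CK_union_discrete by auto
    ultimately show ?thesis unfolding CK_union_discrete using finite_subset by auto
  qed
  have neg_in: "(\<lambda>x. - f x) \<in> CK_union ?X" if "f \<in> CK_union ?X" for f :: "'a \<Rightarrow> 'v"
    using that by (simp add: CK_union_discrete)
  have "continuous_map (prod_topology ?T ?T) ?T (\<lambda>p x. fst p x + snd p x)"
    unfolding continuous_map_def
  proof (intro conjI allI impI)
    show "(\<lambda>p x. fst p x + snd p x) \<in> topspace (prod_topology ?T ?T) \<rightarrow> topspace ?T"
      using sum_in by auto
    fix W assume W: "openin ?T W"
    show "openin (prod_topology ?T ?T) {p \<in> topspace (prod_topology ?T ?T). (\<lambda>x. fst p x + snd p x) \<in> W}"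
      unfolding openin_prod_topology_alt
    proof (intro allI impI)
      fix f g assume "(f, g) \<in> {p \<in> topspace (prod_topology ?T ?T). (\<lambda>x. fst p x + snd p x) \<in> W}"
      then have fg: "f \<in> CK_union ?X" "g \<in> CK_union ?X" "(\<lambda>x. f x + g x) \<in> W" by auto
      obtain N where N: "\<And>x. open (N x)" "\<And>x. 0 \<in> N x"
        "CK_union ?X \<inter> shifted_box (\<lambda>x. f x + g x) N \<subseteq> W"
        using open_box_inside[OF fd e W fg(3)] by blast
      have "\<exists>M. open M \<and> 0 \<in> M \<and> (\<forall>a\<in>M. \<forall>b\<in>M. a + b \<in> N x)" for x
        by (rule balanced_add_nhd[OF N(1)[of x] N(2)[of x]]) blast
      then obtain M where M: "\<And>x. open (M x)" "\<And>x. 0 \<in> M x" "\<And>x. \<forall>a\<in>M x. \<forall>b\<in>M x. a + b \<in> N x"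
        by metis
      have "(\<lambda>x. u x + w x) \<in> W" if u: "u \<in> CK_union ?X \<inter> shifted_box f M"
        and w: "w \<in> CK_union ?X \<inter> shifted_box g M" for u w
      proof -
        have "(u x - f x) + (w x - g x) \<in> N x" for x
          using u w M(3)[of x] by (auto simp: shifted_box_def)
        then have "(\<lambda>x. u x + w x) \<in> shifted_box (\<lambda>x. f x + g x) N"
          by (simp add: shifted_box_def algebra_simps)
        then show ?thesis using N(3) sum_in u w by blast
      qed
      then have "(CK_union ?X \<inter> shifted_box f M) \<times> (CK_union ?X \<inter> shifted_box g M)
          \<subseteq> {p \<in> topspace (prod_topology ?T ?T). (\<lambda>x. fst p x + snd p x) \<in> W}" by auto
      moreover have "f \<in> CK_union ?X \<inter> shifted_box f M" "g \<in> CK_union ?X \<inter> shifted_box g M"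
        using fg M(2) by (auto simp: shifted_box_def)
      ultimately show "\<exists>A B. openin ?T A \<and> openin ?T B \<and> f \<in> A \<and> g \<in> B \<and>
          A \<times> B \<subseteq> {p \<in> topspace (prod_topology ?T ?T). (\<lambda>x. fst p x + snd p x) \<in> W}"
        using openin_shifted_box[of M S f, OF M(1)] openin_shifted_box[of M S g, OF M(1)] by meson
    qed
  qed
  moreover have "continuous_map ?T ?T (\<lambda>f x. - f x)"
    unfolding continuous_map_def
  proof (intro conjI allI impI)
    show "(\<lambda>f x. - f x) \<in> topspace ?T \<rightarrow> topspace ?T" using neg_in by auto
    fix W assume W: "openin ?T W"
    show "openin ?T {f \<in> topspace ?T. (\<lambda>x. - f x) \<in> W}"
    proof (subst openin_subopen, intro ballI)
      fix f assume "f \<in> {f \<in> topspace ?T. (\<lambda>x. - f x) \<in> W}"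
      then have f: "f \<in> CK_union ?X" "(\<lambda>x. - f x) \<in> W" by auto
      obtain N where N: "\<And>x. open (N x)" "\<And>x. 0 \<in> N x" "CK_union ?X \<inter> shifted_box (\<lambda>x. - f x) N \<subseteq> W"
        using open_box_inside[OF fd e W f(2)] by blast
      have "open {u. - u \<in> N x}" for x using open_smult_vimage[OF N(1), of "-1"] by simp
      then have "openin ?T (CK_union ?X \<inter> shifted_box f (\<lambda>x. {u. - u \<in> N x}))"
        by (rule openin_shifted_box)
      moreover have "f \<in> CK_union ?X \<inter> shifted_box f (\<lambda>x. {u. - u \<in> N x})"
        using f N(2) by (simp add: shifted_box_def)
      moreover have "(\<lambda>x. - u x) \<in> W" if "u \<in> CK_union ?X \<inter> shifted_box f (\<lambda>x. {u. - u \<in> N x})" for u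
      proof -
        have "(\<lambda>x. - u x) \<in> shifted_box (\<lambda>x. - f x) N" using that by (simp add: shifted_box_def)
        then show ?thesis using N(3) neg_in that by blast
      qed
      ultimately show "\<exists>A. openin ?T A \<and> f \<in> A \<and> A \<subseteq> {f \<in> topspace ?T. (\<lambda>x. - f x) \<in> W}"
        by (intro exI[of _ "CK_union ?X \<inter> shifted_box f (\<lambda>x. {u. - u \<in> N x})"]) auto
    qed
  qed
  ultimately show ?thesis by (simp add: CK_ACP_def Let_def)
qed

end

section \<open>Spaces homeomorphic to the naturals, and the equivalence\<close>

lemma homeomorphic_space_discrete_nat_iff:
  "X homeomorphic_space discrete_topology (UNIV :: nat set) \<longleftrightarrow>
     X = discrete_topology (topspace X) \<and> (\<exists>e :: nat \<Rightarrow> 'a. bij_betw e UNIV (topspace X))"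
  (is "?L \<longleftrightarrow> ?R")
proof
  assume ?L
  then obtain e where e: "homeomorphic_map (discrete_topology (UNIV :: nat set)) X e"
    by (metis homeomorphic_space homeomorphic_space_sym)
  then have "openin X {e n}" for n
    using homeomorphic_map_openness[OF e, of "{n}"] by simp
  moreover have b: "bij_betw e UNIV (topspace X)"
    using homeomorphic_imp_injective_map[OF e] homeomorphic_imp_surjective_map[OF e]
    by (simp add: bij_betw_def)
  ultimately have "\<forall>x\<in>topspace X. openin X {x}" by (metis bij_betw_imp_surj_on rangeE)
  then show ?R using b discrete_topology_unique by metis
next
  assume R: ?R
  then obtain e :: "nat \<Rightarrow> 'a" where e: "bij_betw e UNIV (topspace X)" by blast
  have "homeomorphic_map (discrete_topology UNIV) (discrete_topology (topspace X)) e"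
    using e by (intro bijective_open_imp_homeomorphic_map) (auto simp: bij_betw_def open_map_def)
  then show ?L using R by (metis homeomorphic_space homeomorphic_space_sym)
qed

theorem theoremB:
  fixes X :: "'a topology"
  assumes "locally_compact_space X" and "Hausdorff_space X"
    and "real_tvs TYPE('v::{real_vector,topological_space})"
    and "metrizable_space (euclidean :: 'v topology)"
    and "\<exists>v::'v. v \<noteq> 0"
    and "\<not> pseudocompact X"
  shows "CK_ACP X TYPE('v) \<longleftrightarrow>
           (X homeomorphic_space discrete_topology (UNIV :: nat set) \<and> finite_dim_space TYPE('v))"
proof -
  interpret hausdorff_tvs "TYPE('v)"
    using assms(3,4) by unfold_locales (auto intro: metrizable_imp_Hausdorff_space)
  obtain v :: 'v where v: "v \<noteq> 0" using assms(5) by blast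
  show ?thesis
  proof (intro iffI conjI)
    assume acp: "CK_ACP X TYPE('v)"
    show "finite_dim_space TYPE('v)"
      by (rule CK_ACP_imp_finite_dim[OF assms(1,2,4) v assms(6) acp])
    have disc: "X = discrete_topology (topspace X)"
      by (rule CK_ACP_imp_discrete[OF assms(1,2,4) v assms(6) acp])
    then have "countable (topspace X)" using CK_ACP_imp_countable[OF v] acp by metis
    \<comment> \<open>An unbounded function cannot live on a finite space, so countable means
      countably infinite here.\<close>
    moreover have "infinite (topspace X)"
      using assms(6) finite_imp_bounded unfolding pseudocompact_def by blast
    ultimately obtain e :: "nat \<Rightarrow> 'a" where "bij_betw e UNIV (topspace X)"
      using bij_betw_from_nat_into by blast
    then show "X homeomorphic_space discrete_topology (UNIV :: nat set)"
      using disc homeomorphic_space_discrete_nat_iff by blast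
  next
    assume "X homeomorphic_space discrete_topology (UNIV :: nat set) \<and> finite_dim_space TYPE('v)"
    then obtain e :: "nat \<Rightarrow> 'a" where "X = discrete_topology (topspace X)"
      "bij_betw e UNIV (topspace X)" "finite_dim_space TYPE('v)"
      unfolding homeomorphic_space_discrete_nat_iff by blast
    then show "CK_ACP X TYPE('v)" using CK_ACP_countable_discrete by metis
  qed
qed

end
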